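(* Let $\kappa_v,\kappa_d,\kappa_f,a_v,a_d,a_f,\sigma_v,\sigma_d,\sigma_f>0$, $\theta_s,\theta_v,\theta_d,\theta_f\ge0$, and let $S_0,V_0,r^d_0,r^f_0>0$ be deterministic. Let $V$, $r^d$, $r^f$ be the pathwise unique non-negative strong solutions, up to Markov times $\tau_0^V,\tau_0^d,\tau_0^f$ respectively, of $$dV(t)=\kappa_v(a_v-V(t-))\,dt+\theta_v\,d\gamma(t)+\sigma_v\sqrt{V(t-)}\,d\Gamma_2(t),\quad V(0)=V_0,$$ $$dr^d(t)=\kappa_d(a_d-r^d(t-))\,dt+\theta_d\,d\gamma(t)+\sigma_d\sqrt{r^d(t-)}\,d\Gamma_3(t),\quad r^d(0)=r^d_0,$$ $$dr^f(t)=\Big(\kappa_f(a_f-r^f(t-))-\sigma_f\rho_{sf}\sqrt{V(t-)r^f(t-)}\Big)dt+\theta_f\,d\gamma(t)+\sigma_f\sqrt{r^f(t-)}\,d\Gamma_4(t),\quad r^f(0)=r^f_0.$$ Then there exists a Markov time $\tau_0^S$ such that the equation $$dS(t)=S(t-)\,(r^d(t-)-r^f(t-))\,dt+S(t-)\big(\theta_s\,d\gamma(t)+\sqrt{V(t-)}\,d\Gamma_1(t)\big),\qquad S(0)=S_0,$$ admits a pathwise unique non-negative càdlàg strong solution up to $\tau_0^S$.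
   Context: Setting. $(\Omega,\mathcal F,\{\mathcal F_t\}_{t\ge0},\mathbf Q)$ is a complete filtered probability space. $\mathbf W=(W_1,W_2,W_3,W_4)$ is a $4$-dimensional Brownian motion with instantaneous correlation matrix $$\Sigma_{\mathbf W}=\begin{pmatrix}1&\rho_{sv}&\rho_{sd}&\rho_{sf}\\ \rho_{sv}&1&\rho_{vd}&\rho_{vf}\\ \rho_{sd}&\rho_{vd}&1&\rho_{df}\\ \rho_{sf}&\rho_{vf}&\rho_{df}&1\end{pmatrix},$$ assumed positive definite with all off-diagonal entries in $(-1,1)$. $\gamma$ is a Gamma subordinator independent of $\mathbf W$: a pure-jump increasing Lévy process with $\gamma(0)=0$ and Lévy measure $g_\gamma(s)\,ds=\frac{\alpha}{s}e^{-\beta s}1_{(0,+\infty)}(s)\,ds$, where $\alpha,\beta>0$ are fixed. $\Gamma_j(t)=W_j(\gamma(t))$, $j=1,\dots,4$; the paths of $\Gamma_j$ are a.s. of bounded variation. $f(t-)$ denotes the left limit of $f$ at $t$. A Markov time is a stopping time. A strong solution of an equation up to a Markov time $\tau$ (with $\mathbf Q(\tau>0)=1$) is a càdlàg process defined on $[0,\tau)$, adapted to the usual augmentation of the filtration generated by the driving processes, satisfying the integral form of the equation for all $t<\tau$ almost surely (for the equation of $S$, the driving processes are $(\gamma,\Gamma_1,\dots,\Gamma_4)$ and $\tau\le\tau_0^V\wedge\tau_0^d\wedge\tau_0^f$). Non-negative means $\ge 0$ on $[0,\tau)$. Pathwise unique means that any other strong solution of the same equation (same initial datum, same driving processes) up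 to a Markov time $\widetilde\tau$ with $\mathbf Q(\widetilde\tau>0)=1$ coincides with it almost surely on $[0,\tau\wedge\widetilde\tau)$. (It is known that the equations for $V$, $r^d$, $r^f$ have pathwise unique non-negative strong solutions up to some Markov times, a.s. positive.) *)

theory Defs
  imports "HOL-Probability.Probability"
begin

text \<open>
  A process is a function of type \<open>real \<Rightarrow> 'a \<Rightarrow> 'b\<close>; only times \<open>t \<ge> 0\<close> are ever looked at.
  Random times take values in \<open>[0, \<infinity>]\<close> and have type \<open>'a \<Rightarrow> ennreal\<close>.
\<close>

section \<open>Paths\<close>

definition left_lim :: "(real \<Rightarrow> real) \<Rightarrow> real \<Rightarrow> real" where
  "left_lim f t = Lim (at_left t) f"

definition jump :: "(real \<Rightarrow> real) \<Rightarrow> real \<Rightarrow> real" where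
  "jump f t = f t - left_lim f t"

definition cadlag_on_before :: "ennreal \<Rightarrow> (real \<Rightarrow> real) \<Rightarrow> bool" where
  "cadlag_on_before T f \<longleftrightarrow>
     (\<forall>t\<ge>0. ennreal t < T \<longrightarrow>
        continuous (at_right t) f \<and> (t > 0 \<longrightarrow> (\<exists>l. (f \<longlongrightarrow> l) (at_left t))))"

text \<open>Total variation of a path over \<open>[0, t]\<close>.\<close>

definition path_variation :: "(real \<Rightarrow> real) \<Rightarrow> real \<Rightarrow> ennreal" where
  "path_variation g t =
     (SUP (n, x) \<in> {(n :: nat, x :: nat \<Rightarrow> real). incseq x \<and> (\<forall>i. 0 \<le> x i \<and> x i \<le> t)}.
        \<Sum>i<n. ennreal \<bar>g (x (Suc i)) - g (x i)\<bar>)"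

definition locally_bounded_variation :: "(real \<Rightarrow> real) \<Rightarrow> bool" where
  "locally_bounded_variation g \<longleftrightarrow> (\<forall>t\<ge>0. path_variation g t < \<top>)"

text \<open>
  The Lebesgue--Stieltjes integral of \<open>f\<close> over \<open>(0, t]\<close> against a right-continuous path \<open>g\<close> of
  locally bounded variation, by the Jordan decomposition \<open>g = (v + g) / 2 - (v - g) / 2\<close>, where
  \<open>v\<close> is the variation function of \<open>g\<close>. Both parts are continued to negative times as constants
  because \<open>interval_measure\<close> expects functions on the whole real line.
\<close>

definition stieltjes_integral :: "(real \<Rightarrow> real) \<Rightarrow> (real \<Rightarrow> real) \<Rightarrow> real \<Rightarrow> real" where
  "stieltjes_integral f g t =
     (let v = (\<lambda>u. enn2real (path_variation g (max 0 u)));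
          h = (\<lambda>u. g (max 0 u))
      in (LINT s:{0<..t}|interval_measure (\<lambda>u. (v u + h u) / 2). f s)
       - (LINT s:{0<..t}|interval_measure (\<lambda>u. (v u - h u) / 2). f s))"


section \<open>Filtrations and Markov times\<close>

definition complete_filtered_prob_space :: "'a measure \<Rightarrow> (real \<Rightarrow> 'a measure) \<Rightarrow> bool" where
  "complete_filtered_prob_space M F \<longleftrightarrow>
     prob_space M \<and> complete_measure M \<and>
     (\<forall>t\<ge>0. subalgebra M (F t)) \<and>
     (\<forall>s t. 0 \<le> s \<and> s \<le> t \<longrightarrow> sets (F s) \<subseteq> sets (F t)) \<and>
     null_sets M \<subseteq> sets (F 0)"

definition adapted :: "(real \<Rightarrow> 'a measure) \<Rightarrow> (real \<Rightarrow> 'a \<Rightarrow> real) \<Rightarrow> bool" where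
  "adapted F X \<longleftrightarrow> (\<forall>t\<ge>0. X t \<in> borel_measurable (F t))"

definition markov_time :: "(real \<Rightarrow> 'a measure) \<Rightarrow> ('a \<Rightarrow> ennreal) \<Rightarrow> bool" where
  "markov_time F \<tau> \<longleftrightarrow> (\<forall>t\<ge>0. Measurable.pred (F t) (\<lambda>\<omega>. \<tau> \<omega> \<le> ennreal t))"

definition process_events ::
    "'a measure \<Rightarrow> real set \<Rightarrow> (real \<Rightarrow> 'a \<Rightarrow> 'b::topological_space) \<Rightarrow> 'a set set" where
  "process_events M T X = {X s -` B \<inter> space M | s B. s \<in> T \<and> B \<in> sets borel}"

text \<open>
  The usual augmentation (null sets added, made right-continuous) of the filtration generated by
  the processes in \<open>D\<close>. It is only used when \<open>M\<close> is complete, where \<open>null_sets M\<close> already contains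
  all negligible sets.
\<close>

definition usual_augmentation ::
    "'a measure \<Rightarrow> (real \<Rightarrow> 'a \<Rightarrow> real) set \<Rightarrow> real \<Rightarrow> 'a measure" where
  "usual_augmentation M D t =
     sigma (space M)
       (\<Inter>u\<in>{t<..}. sigma_sets (space M) ((\<Union>X\<in>D. process_events M {0..u} X) \<union> null_sets M))"

text \<open>
  Adaptedness of a process that is defined on \<open>[0, \<tau>)\<close> only: at each time \<open>t\<close> the variable \<open>X t\<close>,
  which lives on the event \<open>{t < \<tau>}\<close>, is measurable for the trace of \<open>G t\<close> on that event.
\<close>

definition adapted_before ::
    "'a measure \<Rightarrow> (real \<Rightarrow> 'a measure) \<Rightarrow> ('a \<Rightarrow> ennreal) \<Rightarrow> (real \<Rightarrow> 'a \<Rightarrow> real) \<Rightarrow> bool" where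
  "adapted_before M G \<tau> X \<longleftrightarrow>
     (\<forall>t\<ge>0. X t \<in> borel_measurable (restrict_space (G t) {\<omega> \<in> space M. ennreal t < \<tau> \<omega>}))"


section \<open>Driving processes\<close>

definition independent_increments ::
    "'a measure \<Rightarrow> (real \<Rightarrow> 'a \<Rightarrow> 'b::real_normed_vector) \<Rightarrow> bool" where
  "independent_increments M X \<longleftrightarrow>
     (\<forall>(n :: nat) (t :: nat \<Rightarrow> real). 0 \<le> t 0 \<and> incseq t \<longrightarrow>
        prob_space.indep_vars M (\<lambda>_. borel) (\<lambda>i \<omega>. X (t (Suc i)) \<omega> - X (t i) \<omega>) {..<n})"

text \<open>
  Brownian motion with instantaneous correlation matrix \<open>C\<close>: the increment over \<open>[s, t]\<close> is
  centred Gaussian with covariance matrix \<open>(t - s) C\<close>, i.e. each of its linear combinations is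
  normal with the corresponding variance. The matrix \<open>C\<close> is positive definite, hence no
  degenerate normal laws occur for \<open>u \<noteq> 0\<close>.
\<close>

definition correlated_brownian_motion ::
    "'a measure \<Rightarrow> real ^ 'n ^ 'n \<Rightarrow> (real \<Rightarrow> 'a \<Rightarrow> real ^ 'n) \<Rightarrow> bool" where
  "correlated_brownian_motion M C W \<longleftrightarrow>
     (\<forall>t\<ge>0. W t \<in> borel_measurable M) \<and>
     (AE \<omega> in M. W 0 \<omega> = 0) \<and>
     (AE \<omega> in M. continuous_on {0..} (\<lambda>t. W t \<omega>)) \<and>
     independent_increments M W \<and>
     (\<forall>s t u. 0 \<le> s \<and> s < t \<and> u \<noteq> 0 \<longrightarrow>
        distributed M lborel (\<lambda>\<omega>. u \<bullet> (W t \<omega> - W s \<omega>))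
          (normal_density 0 (sqrt ((t - s) * (u \<bullet> (C *v u))))))"

definition positive_definite :: "real ^ 'n ^ 'n \<Rightarrow> bool" where
  "positive_definite C \<longleftrightarrow> transpose C = C \<and> (\<forall>u. u \<noteq> 0 \<longrightarrow> 0 < u \<bullet> (C *v u))"

definition correlation_matrix_4 ::
    "real \<Rightarrow> real \<Rightarrow> real \<Rightarrow> real \<Rightarrow> real \<Rightarrow> real \<Rightarrow> real ^ 4 ^ 4" where
  "correlation_matrix_4 \<rho>sv \<rho>sd \<rho>sf \<rho>vd \<rho>vf \<rho>df =
     vector [vector [1,   \<rho>sv, \<rho>sd, \<rho>sf],
             vector [\<rho>sv, 1,   \<rho>vd, \<rho>vf],
             vector [\<rho>sd, \<rho>vd, 1,   \<rho>df],
             vector [\<rho>sf, \<rho>vf, \<rho>df, 1]]"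

definition levy_process :: "'a measure \<Rightarrow> (real \<Rightarrow> 'a \<Rightarrow> real) \<Rightarrow> bool" where
  "levy_process M X \<longleftrightarrow>
     (\<forall>t\<ge>0. X t \<in> borel_measurable M) \<and>
     (AE \<omega> in M. X 0 \<omega> = 0) \<and>
     (AE \<omega> in M. cadlag_on_before \<top> (\<lambda>t. X t \<omega>)) \<and>
     independent_increments M X \<and>
     (\<forall>s\<ge>0. \<forall>h\<ge>0. distr M borel (\<lambda>\<omega>. X (s + h) \<omega> - X s \<omega>) = distr M borel (X h))"

text \<open>
  \<open>\<nu> B\<close> is the expected number of jumps of \<open>X\<close> in the time interval \<open>(0, 1]\<close> whose size lies
  in \<open>B\<close>.
\<close>

definition has_levy_measure ::
    "'a measure \<Rightarrow> (real \<Rightarrow> 'a \<Rightarrow> real) \<Rightarrow> real measure \<Rightarrow> bool" where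
  "has_levy_measure M X \<nu> \<longleftrightarrow>
     sets \<nu> = sets borel \<and> emeasure \<nu> {0} = 0 \<and>
     (\<forall>B\<in>sets borel. 0 \<notin> B \<longrightarrow>
        (\<integral>\<^sup>+\<omega>. emeasure (count_space UNIV) {s \<in> {0<..1}. jump (\<lambda>t. X t \<omega>) s \<in> B} \<partial>M)
          = emeasure \<nu> B)"

definition gamma_levy_measure :: "real \<Rightarrow> real \<Rightarrow> real measure" where
  "gamma_levy_measure \<alpha> \<beta> =
     density lborel (\<lambda>s. ennreal (\<alpha> / s * exp (- \<beta> * s) * indicator {0<..} s))"

definition gamma_subordinator ::
    "'a measure \<Rightarrow> real \<Rightarrow> real \<Rightarrow> (real \<Rightarrow> 'a \<Rightarrow> real) \<Rightarrow> bool" where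
  "gamma_subordinator M \<alpha> \<beta> \<gamma> \<longleftrightarrow>
     levy_process M \<gamma> \<and>
     (AE \<omega> in M. mono_on {0..} (\<lambda>t. \<gamma> t \<omega>)) \<and>
     (AE \<omega> in M. \<forall>t\<ge>0. (jump (\<lambda>u. \<gamma> u \<omega>) has_sum \<gamma> t \<omega>) {0<..t}) \<and>
     has_levy_measure M \<gamma> (gamma_levy_measure \<alpha> \<beta>)"

definition independent_processes ::
    "'a measure \<Rightarrow> (real \<Rightarrow> 'a \<Rightarrow> 'b::topological_space) \<Rightarrow>
     (real \<Rightarrow> 'a \<Rightarrow> 'c::topological_space) \<Rightarrow> bool" where
  "independent_processes M X Y \<longleftrightarrow>
     prob_space.indep_set M
       (sigma_sets (space M) (process_events M {0..} X))
       (sigma_sets (space M) (process_events M {0..} Y))"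

definition time_changed ::
    "(real \<Rightarrow> 'a \<Rightarrow> real ^ 'n) \<Rightarrow> (real \<Rightarrow> 'a \<Rightarrow> real) \<Rightarrow> 'n \<Rightarrow> real \<Rightarrow> 'a \<Rightarrow> real" where
  "time_changed W \<gamma> j t \<omega> = W (\<gamma> t \<omega>) \<omega> $ j"


section \<open>Strong solutions\<close>

text \<open>
  \<open>E \<omega> x t\<close> says that the path \<open>x\<close> satisfies the integral form of the equation at time \<open>t\<close> in the
  scenario \<open>\<omega>\<close>. \<open>D\<close> is the set of driving processes, and \<open>\<zeta>\<close> is the time up to which the random
  coefficients of the equation are defined.
\<close>

definition strong_solution ::
    "'a measure \<Rightarrow> (real \<Rightarrow> 'a measure) \<Rightarrow> (real \<Rightarrow> 'a \<Rightarrow> real) set \<Rightarrow> ('a \<Rightarrow> ennreal) \<Rightarrow>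
     ('a \<Rightarrow> (real \<Rightarrow> real) \<Rightarrow> real \<Rightarrow> bool) \<Rightarrow> ('a \<Rightarrow> ennreal) \<Rightarrow> (real \<Rightarrow> 'a \<Rightarrow> real) \<Rightarrow> bool" where
  "strong_solution M F D \<zeta> E \<tau> X \<longleftrightarrow>
     markov_time F \<tau> \<and>
     (AE \<omega> in M. 0 < \<tau> \<omega>) \<and>
     (AE \<omega> in M. \<tau> \<omega> \<le> \<zeta> \<omega>) \<and>
     adapted_before M (usual_augmentation M D) \<tau> X \<and>
     (AE \<omega> in M. cadlag_on_before (\<tau> \<omega>) (\<lambda>t. X t \<omega>)) \<and>
     (AE \<omega> in M. \<forall>t\<ge>0. ennreal t < \<tau> \<omega> \<longrightarrow> E \<omega> (\<lambda>s. X s \<omega>) t)"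

definition nonnegative_before ::
    "'a measure \<Rightarrow> ('a \<Rightarrow> ennreal) \<Rightarrow> (real \<Rightarrow> 'a \<Rightarrow> real) \<Rightarrow> bool" where
  "nonnegative_before M \<tau> X \<longleftrightarrow>
     (AE \<omega> in M. \<forall>t\<ge>0. ennreal t < \<tau> \<omega> \<longrightarrow> 0 \<le> X t \<omega>)"

definition pathwise_unique ::
    "'a measure \<Rightarrow> (real \<Rightarrow> 'a measure) \<Rightarrow> (real \<Rightarrow> 'a \<Rightarrow> real) set \<Rightarrow> ('a \<Rightarrow> ennreal) \<Rightarrow>
     ('a \<Rightarrow> (real \<Rightarrow> real) \<Rightarrow> real \<Rightarrow> bool) \<Rightarrow> ('a \<Rightarrow> ennreal) \<Rightarrow> (real \<Rightarrow> 'a \<Rightarrow> real) \<Rightarrow> bool" where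
  "pathwise_unique M F D \<zeta> E \<tau> X \<longleftrightarrow>
     (\<forall>\<tau>' X'. strong_solution M F D \<zeta> E \<tau>' X' \<longrightarrow>
        (AE \<omega> in M. \<forall>t\<ge>0. ennreal t < min (\<tau> \<omega>) (\<tau>' \<omega>) \<longrightarrow> X t \<omega> = X' t \<omega>))"

definition unique_nonnegative_strong_solution ::
    "'a measure \<Rightarrow> (real \<Rightarrow> 'a measure) \<Rightarrow> (real \<Rightarrow> 'a \<Rightarrow> real) set \<Rightarrow> ('a \<Rightarrow> ennreal) \<Rightarrow>
     ('a \<Rightarrow> (real \<Rightarrow> real) \<Rightarrow> real \<Rightarrow> bool) \<Rightarrow> ('a \<Rightarrow> ennreal) \<Rightarrow> (real \<Rightarrow> 'a \<Rightarrow> real) \<Rightarrow> bool" where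
  "unique_nonnegative_strong_solution M F D \<zeta> E \<tau> X \<longleftrightarrow>
     strong_solution M F D \<zeta> E \<tau> X \<and> nonnegative_before M \<tau> X \<and> pathwise_unique M F D \<zeta> E \<tau> X"


section \<open>The equations\<close>

text \<open>
  The first conjunct of the two square-root equations is the requirement that the radicands be
  non-negative; it has to be stated because \<open>sqrt\<close> is a total (odd) function here.
  The arguments \<open>g\<close>, \<open>G\<close>, \<open>v\<close>, \<open>rd\<close>, \<open>rf\<close> are the paths of the driving processes and of the
  coefficient processes.
\<close>

definition cir_equation ::
    "real \<Rightarrow> real \<Rightarrow> real \<Rightarrow> real \<Rightarrow> real \<Rightarrow> (real \<Rightarrow> real) \<Rightarrow> (real \<Rightarrow> real) \<Rightarrow>
     (real \<Rightarrow> real) \<Rightarrow> real \<Rightarrow> bool" where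
  "cir_equation \<kappa> a \<theta> \<sigma> x\<^sub>0 g G x t \<longleftrightarrow>
     (\<forall>s\<in>{0<..t}. 0 \<le> left_lim x s) \<and>
     x t = x\<^sub>0
       + (LINT s:{0..t}|lborel. \<kappa> * (a - left_lim x s))
       + stieltjes_integral (\<lambda>s. \<theta>) g t
       + stieltjes_integral (\<lambda>s. \<sigma> * sqrt (left_lim x s)) G t"

definition foreign_rate_equation ::
    "real \<Rightarrow> real \<Rightarrow> real \<Rightarrow> real \<Rightarrow> real \<Rightarrow> real \<Rightarrow> (real \<Rightarrow> real) \<Rightarrow> (real \<Rightarrow> real) \<Rightarrow>
     (real \<Rightarrow> real) \<Rightarrow> (real \<Rightarrow> real) \<Rightarrow> real \<Rightarrow> bool" where
  "foreign_rate_equation \<kappa> a \<theta> \<sigma> \<rho> x\<^sub>0 g G v x t \<longleftrightarrow>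
     (\<forall>s\<in>{0<..t}. 0 \<le> left_lim x s \<and> 0 \<le> left_lim v s * left_lim x s) \<and>
     x t = x\<^sub>0
       + (LINT s:{0..t}|lborel.
            \<kappa> * (a - left_lim x s) - \<sigma> * \<rho> * sqrt (left_lim v s * left_lim x s))
       + stieltjes_integral (\<lambda>s. \<theta>) g t
       + stieltjes_integral (\<lambda>s. \<sigma> * sqrt (left_lim x s)) G t"

definition exchange_rate_equation ::
    "real \<Rightarrow> real \<Rightarrow> (real \<Rightarrow> real) \<Rightarrow> (real \<Rightarrow> real) \<Rightarrow>
     (real \<Rightarrow> real) \<Rightarrow> (real \<Rightarrow> real) \<Rightarrow> (real \<Rightarrow> real) \<Rightarrow> (real \<Rightarrow> real) \<Rightarrow> real \<Rightarrow> bool" where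
  "exchange_rate_equation \<theta> x\<^sub>0 g G v rd rf x t \<longleftrightarrow>
     x t = x\<^sub>0
       + (LINT s:{0..t}|lborel. left_lim x s * (left_lim rd s - left_lim rf s))
       + stieltjes_integral (\<lambda>s. left_lim x s * \<theta>) g t
       + stieltjes_integral (\<lambda>s. left_lim x s * sqrt (left_lim v s)) G t"

end

theory Submission
  imports Defs
begin

text \<open>
  Path by path, the equation is a linear equation \<open>dS = S(t-) dL\<close> whose integrators have locally
  bounded variation. Splitting them by the Jordan decomposition, Picard iteration contracts in a
  supremum norm with an exponential weight of the integrators, which yields existence and
  uniqueness up to the minimum \<open>\<zeta>\<close> of the lifetimes of the coefficients. The iterates are limits
  of left-endpoint Riemann--Stieltjes sums, hence adapted. The solution is stopped when it first
  fails to be positive; since it stays at \<open>0\<close> after hitting \<open>0\<close>, this time is detected by the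
  values at the rational times up to \<open>t\<close> and at \<open>t\<close> itself.
\<close>

section \<open>The variation function\<close>

text \<open>Two obstacles shape the proof. Pathwise, the integrators may jump by amounts of any
  size, so shortening the time interval does not by itself give a contraction; the weight has to
  grow with the integrators and has to be paired with left limits, as the integrands are. The jumps
  are also what forces the stopping: where \<open>\<theta>s\<close> times the jump of
  \<open>\<gamma>\<close> plus \<open>sqrt (V(s-))\<close> times the jump of
  \<open>\<Gamma> 1\<close> is below -1, a positive solution turns negative, and where it equals -1,
  the solution lands on 0. On the measurable side two filtrations compete. Markov times refer to
  \<open>F\<close>, which need not be right-continuous, whereas the coefficients are adapted to an
  augmentation that at time \<open>t\<close> may look infinitesimally beyond \<open>t\<close>. Sums
  with left endpoints read the coefficients strictly before \<open>t\<close>, and there the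
  augmentation does lie in \<open>F t\<close>. This is why the lemmas on measurability distinguish
  \<open>s < t\<close> from \<open>s \<le> t\<close>.\<close>

definition variation_sum :: "(real \<Rightarrow> real) \<Rightarrow> nat \<Rightarrow> (nat \<Rightarrow> real) \<Rightarrow> real" where
  "variation_sum g n x = (\<Sum>i<n. \<bar>g (x (Suc i)) - g (x i)\<bar>)"

definition variation :: "(real \<Rightarrow> real) \<Rightarrow> real \<Rightarrow> real" where
  "variation g t = enn2real (path_variation g t)"

lemma path_variation_eq_SUP:
  "path_variation g t =
     (SUP (n, x) \<in> {(n :: nat, x). incseq x \<and> (\<forall>i. 0 \<le> x i \<and> x i \<le> t)}.
        ennreal (variation_sum g n x))"
  unfolding path_variation_def variation_sum_def by (simp add: sum_ennreal)

lemma path_variation_least: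
  assumes "\<And>n x. incseq x \<Longrightarrow> (\<And>i. 0 \<le> x i \<and> x i \<le> t) \<Longrightarrow> ennreal (variation_sum g n x) \<le> B"
  shows "path_variation g t \<le> B"
  unfolding path_variation_eq_SUP using assms by (intro SUP_least) auto

lemma variation_sum_le_path_variation:
  assumes "incseq x" "\<And>i. 0 \<le> x i \<and> x i \<le> t"
  shows "ennreal (variation_sum g n x) \<le> path_variation g t"
proof -
  have "(n, x) \<in> {(n :: nat, x). incseq x \<and> (\<forall>i. 0 \<le> x i \<and> x i \<le> t)}"
    using assms by auto
  from SUP_upper[OF this, of "\<lambda>(n, x). ennreal (variation_sum g n x)"]
  show ?thesis by (simp add: path_variation_eq_SUP)
qed

lemma variation_nonneg: "0 \<le> variation g t"
  by (simp add: variation_def)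

lemma ennreal_variation:
  assumes "locally_bounded_variation g" "0 \<le> t"
  shows "ennreal (variation g t) = path_variation g t"
  using assms unfolding variation_def locally_bounded_variation_def by simp

lemma variation_sum_le_variation:
  assumes "locally_bounded_variation g" "0 \<le> t"
    and "incseq x" "\<And>i. 0 \<le> x i \<and> x i \<le> t"
  shows "variation_sum g n x \<le> variation g t"
  using variation_sum_le_path_variation[OF assms(3,4), of g n]
  by (simp add: ennreal_variation[OF assms(1,2), symmetric] variation_nonneg)

lemma variation_approx:
  assumes "locally_bounded_variation g" "0 \<le> t" "e > 0"
  shows "\<exists>n x. incseq x \<and> (\<forall>i. 0 \<le> x i \<and> x i \<le> t) \<and> variation g t \<le> variation_sum g n x + e"
proof (rule ccontr)
  assume neg: "\<not> ?thesis"
  have *: "variation_sum g n x \<le> variation g t - e"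
    if "incseq x" "\<And>i. 0 \<le> x i \<and> x i \<le> t" for n x
  proof (rule ccontr)
    assume "\<not> variation_sum g n x \<le> variation g t - e"
    then have "variation g t \<le> variation_sum g n x + e" by simp
    with that neg show False by blast
  qed
  \<comment> \<open>Obtained from the empty sum. It matters because \<open>ennreal\<close> sends
    negative reals to 0: without it, the bound below would be compatible with a vanishing
    variation.\<close>
  have "0 \<le> variation g t - e"
    using *[of "\<lambda>_. 0" 0] assms(2) by (simp add: variation_sum_def incseq_def)
  moreover have "path_variation g t \<le> ennreal (variation g t - e)"
    using * by (intro path_variation_least ennreal_leI) auto
  ultimately show False
    using assms(3) by (simp add: ennreal_variation[OF assms(1,2), symmetric])
qed

text \<open>A nearly optimal partition up to \<open>u\<close> is prolonged by the points of
  \<open>y\<close>, and the result competes for the variation up to \<open>b\<close>. This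
  superadditivity serves twice: with a two-point \<open>y\<close> for increments, and for the
  right-continuity of the variation.\<close>

lemma variation_add_variation_sum_le:
  assumes "locally_bounded_variation g" "0 \<le> u" "u \<le> b"
    and y: "incseq y" "\<And>i. u \<le> y i \<and> y i \<le> b"
  shows "variation g u + variation_sum g m y \<le> variation g b"
proof (rule field_le_epsilon)
  fix e :: real assume "e > 0"
  then obtain n x where x: "incseq x" "\<And>i. 0 \<le> x i \<and> x i \<le> u"
      and *: "variation g u \<le> variation_sum g n x + e"
    using variation_approx[OF assms(1,2)] by blast
  \<comment> \<open>Indices up to \<open>n\<close> carry \<open>x\<close>, and \<open>y 0\<close>
    sits at \<open>Suc n\<close>. The bridge from \<open>x n\<close> to \<open>y 0\<close> is one
    extra nonnegative term, hence \<open>Suc n + m\<close> terms.\<close>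
  define z where "z i = (if i \<le> n then x i else y (i - Suc n))" for i
  have "variation_sum g n x + variation_sum g m y \<le> variation_sum g (Suc n + m) z"
  proof (induction m)
    case 0
    have "variation_sum g n x = variation_sum g n z"
      unfolding variation_sum_def z_def by (intro sum.cong) auto
    then show ?case by (simp add: variation_sum_def)
  next
    case (Suc m)
    then show ?case by (simp add: variation_sum_def z_def)
  qed
  also have "\<dots> \<le> variation g b"
  proof (rule variation_sum_le_variation)
    show "incseq z"
    proof (rule incseq_SucI)
      fix i
      consider "Suc i \<le> n" | "i = n" | "i > n" by linarith
      then show "z i \<le> z (Suc i)"
      proof cases
        case 1
        then show ?thesis using x(1) by (simp add: z_def incseq_SucD)
      next
        case 2
        then show ?thesis using x(2)[of n] y(2)[of 0] by (simp add: z_def)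
      next
        case 3
        then have "Suc i - Suc n = Suc (i - Suc n)" by simp
        with 3 show ?thesis using y(1) unfolding z_def by (simp add: incseq_def del: diff_Suc_Suc)
      qed
    qed
    show "0 \<le> z i \<and> z i \<le> b" for i
      using x(2)[of i] y(2)[of "i - Suc n"] assms(2,3) by (auto simp: z_def)
  qed (use assms in auto)
  finally show "variation g u + variation_sum g m y \<le> variation g b + e"
    using * by linarith
qed

lemma abs_diff_le_variation_diff:
  assumes "locally_bounded_variation g" "0 \<le> s" "s \<le> t"
  shows "\<bar>g t - g s\<bar> \<le> variation g t - variation g s"
proof -
  have "variation g s + variation_sum g 1 (\<lambda>i. if i = 0 then s else t) \<le> variation g t"
    using assms by (intro variation_add_variation_sum_le) (auto simp: incseq_def)
  then show ?thesis by (simp add: variation_sum_def)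
qed

text \<open>A nearly optimal partition up to \<open>s + 1\<close> (just some point to the right of
  \<open>s\<close>) is cut at \<open>u\<close>. The part after \<open>u\<close> contributes at most
  \<open>variation g (s + 1) - variation g u\<close>, so the part before \<open>u\<close> nearly
  attains \<open>variation g u\<close>. It consists of finitely many values of \<open>g\<close>
  clipped at \<open>u\<close>; as \<open>u\<close> decreases to \<open>s\<close>, it tends to the
  sum clipped at \<open>s\<close>, which is at most \<open>variation g s\<close>.\<close>

lemma variation_right_continuous:
  assumes bv: "locally_bounded_variation g" and "0 \<le> s"
    and rc: "(g \<longlongrightarrow> g s) (at_right s)"
  shows "(variation g \<longlongrightarrow> variation g s) (at_right s)"
proof (rule tendstoI)
  fix e :: real assume "e > 0"
  have 0: "0 \<le> s + 1" using assms(2) by simp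
  obtain n x where x: "incseq x" "\<And>i. 0 \<le> x i \<and> x i \<le> s + 1"
      and approx: "variation g (s + 1) \<le> variation_sum g n x + e / 2"
    using variation_approx[OF bv 0, of "e / 2"] \<open>e > 0\<close> by (auto simp del: le_divide_eq_numeral1)
  have "((\<lambda>u. g (min (x i) u)) \<longlongrightarrow> g (min (x i) s)) (at_right s)" for i
  proof (cases "x i \<le> s")
    case True
    then have "eventually (\<lambda>u. g (min (x i) u) = g (min (x i) s)) (at_right s)"
      by (intro eventually_mono[OF eventually_at_right_less]) (auto simp: min_def)
    then show ?thesis by (simp add: tendsto_eventually)
  next
    case False
    then have "eventually (\<lambda>u. g (min (x i) u) = g u) (at_right s)"
      using eventually_at_right_real[of s "x i"] by (auto elim!: eventually_mono simp: min_def)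
    then show ?thesis using rc False by (simp add: min_def tendsto_cong)
  qed
  then have "((\<lambda>u. variation_sum g n (\<lambda>i. min (x i) u)) \<longlongrightarrow> variation_sum g n (\<lambda>i. min (x i) s))
     (at_right s)"
    unfolding variation_sum_def by (intro tendsto_intros)
  then have "eventually (\<lambda>u. dist (variation_sum g n (\<lambda>i. min (x i) u))
      (variation_sum g n (\<lambda>i. min (x i) s)) < e / 2) (at_right s)"
    using \<open>e > 0\<close> by (intro tendstoD) auto
  moreover have "eventually (\<lambda>u. u \<in> {s<..<s + 1}) (at_right s)"
    by (intro eventually_at_right_real) simp
  ultimately show "eventually (\<lambda>u. dist (variation g u) (variation g s) < e) (at_right s)"
  proof eventually_elim
    case (elim u)
    \<comment> \<open>Only the cell around \<open>u\<close> needs the triangle inequality; in every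
      other cell one of the two clipped increments vanishes.\<close>
    have "variation_sum g n x \<le> variation_sum g n (\<lambda>i. min (x i) u) + variation_sum g n (\<lambda>i. max (x i) u)"
      unfolding variation_sum_def sum.distrib[symmetric]
    proof (rule sum_mono)
      fix i
      have "x i \<le> x (Suc i)" using x(1) by (simp add: incseq_SucD)
      then show "\<bar>g (x (Suc i)) - g (x i)\<bar> \<le> \<bar>g (min (x (Suc i)) u) - g (min (x i) u)\<bar>
          + \<bar>g (max (x (Suc i)) u) - g (max (x i) u)\<bar>"
        by (cases "x i \<le> u"; cases "x (Suc i) \<le> u") (simp_all add: min_def max_def)
    qed
    moreover have "variation g u + variation_sum g n (\<lambda>i. max (x i) u) \<le> variation g (s + 1)"
    proof (rule variation_add_variation_sum_le[OF bv])
      show "incseq (\<lambda>i. max (x i) u)" using x(1) by (auto simp: incseq_def max_def) (meson order_trans)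
    qed (use x(2) elim(2) \<open>0 \<le> s\<close> in auto)
    moreover have "variation_sum g n (\<lambda>i. min (x i) s) \<le> variation g s"
    proof (rule variation_sum_le_variation[OF bv \<open>0 \<le> s\<close>])
      show "incseq (\<lambda>i. min (x i) s)" using x(1) by (auto simp: incseq_def min_def) (meson order_trans)
    qed (use x(2) \<open>0 \<le> s\<close> in auto)
    moreover have "variation g s \<le> variation g u"
      using abs_diff_le_variation_diff[OF bv, of s u] elim(2) \<open>0 \<le> s\<close> by auto
    ultimately show ?case using elim(1) approx unfolding dist_real_def by linarith
  qed
qed

lemma mono_on_imp_locally_bounded_variation:
  assumes "mono_on {0..} g"
  shows "locally_bounded_variation g"
  unfolding locally_bounded_variation_def
proof (intro allI impI)
  fix t :: real assume "0 \<le> t"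
  have "path_variation g t \<le> ennreal (g t - g 0)"
  proof (intro path_variation_least ennreal_leI)
    fix n :: nat and x :: "nat \<Rightarrow> real" assume x: "incseq x" "\<And>i. 0 \<le> x i \<and> x i \<le> t"
    have "variation_sum g n x = (\<Sum>i<n. g (x (Suc i)) - g (x i))"
      unfolding variation_sum_def
      using x assms by (intro sum.cong abs_of_nonneg) (auto simp: incseq_SucD intro!: mono_onD[OF assms])
    also have "\<dots> = g (x n) - g (x 0)" by (rule sum_lessThan_telescope)
    also have "\<dots> \<le> g t - g 0"
      using x \<open>0 \<le> t\<close> by (intro diff_mono mono_onD[OF assms]) auto
    finally show "variation_sum g n x \<le> g t - g 0" .
  qed
  also have "\<dots> < \<top>" by simp
  finally show "path_variation g t < \<top>" .
qed


section \<open>Riemann--Stieltjes sums\<close>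

text \<open>Only the mass of half-open intervals in the nonnegative half-line is prescribed. This
  treats \<open>lborel\<close> with the identity and the measures of the Jordan parts alike.\<close>

definition increment_measure :: "real measure \<Rightarrow> (real \<Rightarrow> real) \<Rightarrow> bool" where
  "increment_measure \<mu> g \<longleftrightarrow>
     sets \<mu> = sets borel \<and> mono_on {0..} g \<and>
     (\<forall>a b. 0 \<le> a \<and> a \<le> b \<longrightarrow> emeasure \<mu> {a<..b} = ennreal (g b - g a))"

lemma increment_measureD:
  assumes "increment_measure \<mu> g"
  shows "sets \<mu> = sets borel" "space \<mu> = UNIV"
    and "0 \<le> a \<Longrightarrow> a \<le> b \<Longrightarrow> g a \<le> g b"
    and "0 \<le> a \<Longrightarrow> a \<le> b \<Longrightarrow> emeasure \<mu> {a<..b} = ennreal (g b - g a)"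
    and "0 \<le> a \<Longrightarrow> a \<le> b \<Longrightarrow> measure \<mu> {a<..b} = g b - g a"
proof -
  show *: "sets \<mu> = sets borel" using assms by (simp add: increment_measure_def)
  then show "space \<mu> = UNIV" using sets_eq_imp_space_eq[of \<mu> borel] by simp
  show mono: "0 \<le> a \<Longrightarrow> a \<le> b \<Longrightarrow> g a \<le> g b"
    using assms by (auto simp: increment_measure_def intro: mono_onD)
  show 1: "0 \<le> a \<Longrightarrow> a \<le> b \<Longrightarrow> emeasure \<mu> {a<..b} = ennreal (g b - g a)"
    using assms by (auto simp: increment_measure_def)
  show "0 \<le> a \<Longrightarrow> a \<le> b \<Longrightarrow> measure \<mu> {a<..b} = g b - g a"
    using 1 mono by (simp add: measure_def)
qed

lemma increment_measure_lborel: "increment_measure lborel (\<lambda>s. s)"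
  unfolding increment_measure_def by (auto intro!: mono_onI)

lemma set_integrable_bounded:
  fixes f :: "real \<Rightarrow> real"
  assumes "increment_measure \<mu> g" "0 \<le> a"
    and "(\<lambda>s. indicator {a<..b} s * f s) \<in> borel_measurable borel"
    and "\<And>s. a < s \<Longrightarrow> s \<le> b \<Longrightarrow> \<bar>f s\<bar> \<le> K"
  shows "set_integrable \<mu> {a<..b} f"
proof (cases "a \<le> b")
  case True
  note [measurable_cong] = increment_measureD(1)[OF assms(1)]
  show ?thesis
    unfolding set_integrable_def
  proof (rule integrableI_bounded_set[where A = "{a<..b}" and B = K])
    show "(\<lambda>x. indicat_real {a<..b} x *\<^sub>R f x) \<in> borel_measurable \<mu>"
      using assms(3) by (simp add: measurable_cong_sets[OF increment_measureD(1)[OF assms(1)] refl])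
    show "{a<..b} \<in> sets \<mu>" using increment_measureD(1)[OF assms(1)] by simp
    show "emeasure \<mu> {a<..b} < \<infinity>"
      using increment_measureD(4)[OF assms(1,2) True] by simp
  qed (use assms(4) in \<open>auto simp: indicator_def\<close>)
qed (simp add: set_integrable_def)

definition grid :: "real \<Rightarrow> real \<Rightarrow> nat \<Rightarrow> nat \<Rightarrow> real" where
  "grid a b m j = a + (b - a) * real j / real m"

text \<open>\<open>Suc m\<close> cells avoid a division by zero at \<open>m = 0\<close>. Evaluating
  \<open>X\<close> at left endpoints keeps the sum non-anticipating: for \<open>a < b\<close> the
  value \<open>X b\<close> never occurs.\<close>

definition left_sum ::
    "(real \<Rightarrow> real) \<Rightarrow> (real \<Rightarrow> real) \<Rightarrow> real \<Rightarrow> real \<Rightarrow> nat \<Rightarrow> real" where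
  "left_sum X g a b m =
     (\<Sum>j<Suc m. X (grid a b (Suc m) j) * (g (grid a b (Suc m) (Suc j)) - g (grid a b (Suc m) j)))"

text \<open>The step function whose integral is \<open>left_sum\<close>. Its cells are open on the
  left, so its value at \<open>s\<close> is read off at a point strictly before
  \<open>s\<close>.\<close>

definition left_step :: "(real \<Rightarrow> real) \<Rightarrow> real \<Rightarrow> real \<Rightarrow> nat \<Rightarrow> real \<Rightarrow> real" where
  "left_step X a b m s =
     (\<Sum>j<Suc m. X (grid a b (Suc m) j) * indicator {grid a b (Suc m) j<..grid a b (Suc m) (Suc j)} s)"

lemma grid_0 [simp]: "grid a b m 0 = a"
  by (simp add: grid_def)

lemma grid_end [simp]: "m > 0 \<Longrightarrow> grid a b m m = b"
  by (simp add: grid_def)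

lemma grid_mono: "a \<le> b \<Longrightarrow> i \<le> j \<Longrightarrow> grid a b m i \<le> grid a b m j"
  unfolding grid_def by (auto intro!: divide_right_mono mult_left_mono)

lemma grid_le: "a \<le> b \<Longrightarrow> j \<le> m \<Longrightarrow> m > 0 \<Longrightarrow> grid a b m j \<le> b"
  using grid_mono[of a b j m m] by simp

lemma grid_ge: "a \<le> b \<Longrightarrow> a \<le> grid a b m j"
  using grid_mono[of a b 0 j m] by simp

lemma grid_less: "a < b \<Longrightarrow> j < m \<Longrightarrow> grid a b m j < b"
  using mult_strict_left_mono[of "real j / real m" 1 "b - a"] by (simp add: grid_def)

lemma grid_cell_exists:
  assumes "a < b" "s \<in> {a<..b}"
  obtains j where "j < Suc m" "grid a b (Suc m) j < s" "s \<le> grid a b (Suc m) (Suc j)"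
proof -
  define k where "k = (LEAST k. s \<le> grid a b (Suc m) k)"
  have top: "s \<le> grid a b (Suc m) (Suc m)" using assms by simp
  have k: "s \<le> grid a b (Suc m) k" unfolding k_def using top by (rule LeastI)
  have "k \<le> Suc m" unfolding k_def using top by (rule Least_le)
  have "k \<noteq> 0" using k assms by (intro notI) simp
  then obtain j where j: "k = Suc j" using not0_implies_Suc by blast
  have "\<not> s \<le> grid a b (Suc m) j" using not_less_Least[of j "\<lambda>k. s \<le> grid a b (Suc m) k"] j
    by (simp add: k_def)
  with that[of j] j k \<open>k \<le> Suc m\<close> show thesis by simp
qed

lemma left_step_eq:
  assumes "a < b" "j < Suc m" "grid a b (Suc m) j < s" "s \<le> grid a b (Suc m) (Suc j)"
  shows "left_step X a b m s = X (grid a b (Suc m) j)"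
proof -
  have "left_step X a b m s = (\<Sum>i<Suc m. if i = j then X (grid a b (Suc m) j) else 0)"
    unfolding left_step_def
  proof (intro sum.cong refl)
    fix i
    show "X (grid a b (Suc m) i) * indicator {grid a b (Suc m) i<..grid a b (Suc m) (Suc i)} s
        = (if i = j then X (grid a b (Suc m) j) else 0)"
      using assms grid_mono[of a b "Suc i" j "Suc m"] grid_mono[of a b "Suc j" i "Suc m"]
      by (cases i j rule: linorder_cases) (auto simp: indicator_def)
  qed
  then show ?thesis using assms(2) by simp
qed

lemma left_step_outside:
  assumes "a < b" "s \<notin> {a<..b}"
  shows "left_step X a b m s = 0"
  unfolding left_step_def
proof (rule sum.neutral, intro ballI)
  fix j assume "j \<in> {..<Suc m}"
  then have "a \<le> grid a b (Suc m) j" "grid a b (Suc m) (Suc j) \<le> b"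
    using assms by (auto intro!: grid_ge grid_le)
  with assms(2) show "X (grid a b (Suc m) j) *
      indicator {grid a b (Suc m) j<..grid a b (Suc m) (Suc j)} s = 0"
    by (auto simp: indicator_def)
qed

text \<open>The left endpoint of the cell of \<open>s\<close> lies strictly before \<open>s\<close>
  and within one mesh width of it, so it approaches \<open>s\<close> from the left; a jump of
  \<open>X\<close> at \<open>s\<close> is not seen.\<close>

lemma left_step_tendsto:
  assumes "a < b" "s \<in> {a<..b}" "(X \<longlongrightarrow> l) (at_left s)"
  shows "(\<lambda>m. left_step X a b m s) \<longlonglongrightarrow> l"
proof (rule tendstoI)
  fix e :: real assume "e > 0"
  with assms(3) have "eventually (\<lambda>y. dist (X y) l < e) (at_left s)" by (rule tendstoD)
  then obtain d where d: "d < s" "\<And>y. d < y \<Longrightarrow> y < s \<Longrightarrow> dist (X y) l < e"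
    by (auto simp: eventually_at_left_field)
  have "(\<lambda>m. (b - a) * inverse (real (Suc m))) \<longlonglongrightarrow> (b - a) * 0"
    by (intro tendsto_intros LIMSEQ_inverse_real_of_nat)
  then have "eventually (\<lambda>m. (b - a) * inverse (real (Suc m)) < s - d) sequentially"
    using d(1) by (intro order_tendstoD(2)) auto
  then show "eventually (\<lambda>m. dist (left_step X a b m s) l < e) sequentially"
  proof eventually_elim
    case (elim m)
    obtain j where j: "j < Suc m" "grid a b (Suc m) j < s" "s \<le> grid a b (Suc m) (Suc j)"
      using grid_cell_exists[OF assms(1,2)] by blast
    have "grid a b (Suc m) (Suc j) = grid a b (Suc m) j + (b - a) * inverse (real (Suc m))"
      by (simp add: grid_def divide_inverse algebra_simps)
    with j elim have "d < grid a b (Suc m) j" by linarith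
    with d(2) j show ?case by (simp add: left_step_eq[OF assms(1) j])
  qed
qed

lemma left_step_bounded:
  assumes "a < b" "\<And>s. a \<le> s \<Longrightarrow> s < b \<Longrightarrow> \<bar>X s\<bar> \<le> K"
  shows "\<bar>left_step X a b m s\<bar> \<le> K * indicator {a<..b} s"
proof (cases "s \<in> {a<..b}")
  case True
  obtain j where j: "j < Suc m" "grid a b (Suc m) j < s" "s \<le> grid a b (Suc m) (Suc j)"
    using grid_cell_exists[OF assms(1) True] by blast
  show ?thesis
    using True assms(2) grid_ge[of a b "Suc m" j] grid_less[of a b j "Suc m"] assms(1) j(1)
    by (simp add: left_step_eq[OF assms(1) j])
qed (simp add: left_step_outside[OF assms(1)])

lemma left_step_borel [measurable]: "left_step X a b m \<in> borel_measurable borel"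
  unfolding left_step_def by measurable

text \<open>The left limit is a pointwise limit of the step functions \<open>left_step\<close>,
  which are Borel whatever \<open>X\<close> is.\<close>

lemma borel_measurable_left_limit:
  fixes X f :: "real \<Rightarrow> real"
  assumes "\<And>s. a < s \<Longrightarrow> s \<le> b \<Longrightarrow> (X \<longlongrightarrow> f s) (at_left s)"
  shows "(\<lambda>s. indicator {a<..b} s * f s) \<in> borel_measurable borel"
proof (cases "a < b")
  case True
  show ?thesis
  proof (rule borel_measurable_LIMSEQ_real)
    show "(\<lambda>m. left_step X a b m s) \<longlonglongrightarrow> indicator {a<..b} s * f s" for s
      using left_step_tendsto[OF True, of s X "f s"] assms left_step_outside[OF True, of s X]
      by (cases "s \<in> {a<..b}") auto
  qed simp
qed simp

text \<open>Dominated convergence for the step functions, with a constant as majorant on an interval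
  of finite mass. Atoms of \<open>\<mu>\<close> do no harm, because the convergence holds at every
  point and not merely almost everywhere.\<close>

theorem left_sum_tendsto:
  fixes X f :: "real \<Rightarrow> real"
  assumes \<mu>: "increment_measure \<mu> g" and "0 \<le> a" "a \<le> b"
    and lim: "\<And>s. a < s \<Longrightarrow> s \<le> b \<Longrightarrow> (X \<longlongrightarrow> f s) (at_left s)"
    and bound: "\<And>s. a \<le> s \<Longrightarrow> s < b \<Longrightarrow> \<bar>X s\<bar> \<le> K"
  shows "left_sum X g a b \<longlonglongrightarrow> (LINT s:{a<..b}|\<mu>. f s)"
proof (cases "a < b")
  case True
  note [measurable_cong] = increment_measureD(1)[OF \<mu>]
  have fin: "emeasure \<mu> {u<..v} < \<infinity>" if "a \<le> u" "u \<le> v" for u v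
    using increment_measureD(4)[OF \<mu>, of u v] that \<open>0 \<le> a\<close> by simp
  have "(\<integral>s. left_step X a b m s \<partial>\<mu>) = left_sum X g a b m" for m
  proof -
    have *: "integrable \<mu> (\<lambda>s. X (grid a b (Suc m) j) *
        indicator {grid a b (Suc m) j<..grid a b (Suc m) (Suc j)} s)" for j
      using True by (intro integrable_mult_right integrable_real_indicator fin)
        (auto intro!: grid_ge grid_mono)
    have "measure \<mu> {grid a b (Suc m) j<..grid a b (Suc m) (Suc j)}
        = g (grid a b (Suc m) (Suc j)) - g (grid a b (Suc m) j)" for j
      using True \<open>0 \<le> a\<close> grid_ge[of a b "Suc m" j]
      by (intro increment_measureD(5)[OF \<mu>] grid_mono) auto
    then show ?thesis
      unfolding left_step_def left_sum_def
      by (subst Bochner_Integration.integral_sum[OF *])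
        (simp add: increment_measureD(2)[OF \<mu>] del: sum.lessThan_Suc)
  qed
  moreover have "(\<lambda>m. \<integral>s. left_step X a b m s \<partial>\<mu>) \<longlonglongrightarrow> (\<integral>s. indicator {a<..b} s *\<^sub>R f s \<partial>\<mu>)"
  proof (rule integral_dominated_convergence[where w = "\<lambda>s. K * indicator {a<..b} s"])
    show "(\<lambda>s. indicator {a<..b} s *\<^sub>R f s) \<in> borel_measurable \<mu>"
      using borel_measurable_left_limit[OF lim, of a b] by simp
    show "integrable \<mu> (\<lambda>s. K * indicator {a<..b} s)"
      using fin[of a b] True by (intro integrable_mult_right integrable_real_indicator) auto
    show "AE s in \<mu>. (\<lambda>m. left_step X a b m s) \<longlonglongrightarrow> indicator {a<..b} s *\<^sub>R f s"
      using left_step_tendsto[OF True, of _ X] lim left_step_outside[OF True, of _ X]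
      by (intro AE_I2) (auto simp: indicator_def)
    show "AE s in \<mu>. norm (left_step X a b m s) \<le> K * indicator {a<..b} s" for m
      using left_step_bounded[OF True bound] by simp
  qed simp
  ultimately show ?thesis by (simp add: set_lebesgue_integral_def)
next
  case False
  with \<open>a \<le> b\<close> have "a = b" by simp
  moreover have "left_sum X g b b = (\<lambda>_. 0)" by (simp add: left_sum_def grid_def fun_eq_iff)
  ultimately show ?thesis by (simp add: set_lebesgue_integral_def)
qed


section \<open>Jordan decomposition\<close>

definition jordan_pos :: "(real \<Rightarrow> real) \<Rightarrow> real \<Rightarrow> real" where
  "jordan_pos g u = (variation g (max 0 u) + g (max 0 u)) / 2"

definition jordan_neg :: "(real \<Rightarrow> real) \<Rightarrow> real \<Rightarrow> real" where
  "jordan_neg g u = (variation g (max 0 u) - g (max 0 u)) / 2"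

lemma stieltjes_integral_eq:
  "stieltjes_integral f g t =
     (LINT s:{0<..t}|interval_measure (jordan_pos g). f s)
     - (LINT s:{0<..t}|interval_measure (jordan_neg g). f s)"
  unfolding stieltjes_integral_def jordan_pos_def jordan_neg_def variation_def Let_def ..

text \<open>An increment of \<open>g\<close> is dominated by that of its variation, which makes both
  halves increasing; their right-continuity comes from that of the variation. These are the two
  conditions under which \<open>interval_measure\<close> has the prescribed increments.\<close>

lemma increment_measure_jordan:
  assumes bv: "locally_bounded_variation g"
    and rc: "\<And>s. 0 \<le> s \<Longrightarrow> (g \<longlongrightarrow> g s) (at_right s)"
  shows "increment_measure (interval_measure (jordan_pos g)) (jordan_pos g)"
    and "increment_measure (interval_measure (jordan_neg g)) (jordan_neg g)"
proof -
  have cont: "continuous (at_right s) (\<lambda>u. h (max 0 u))"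
    if "\<And>s. 0 \<le> s \<Longrightarrow> (h \<longlongrightarrow> h s) (at_right s)" for h :: "real \<Rightarrow> real" and s
  proof (cases "0 \<le> s")
    case True
    then have "eventually (\<lambda>u. h (max 0 u) = h u) (at_right s)"
      by (intro eventually_mono[OF eventually_at_right_less]) (auto simp: max_def)
    with that[OF True] True show ?thesis
      by (simp add: continuous_within max_def tendsto_cong)
  next
    case False
    then have "eventually (\<lambda>u. h (max 0 u) = h (max 0 s)) (at_right s)"
      using eventually_at_right_real[of s 0] by (auto elim!: eventually_mono)
    then show ?thesis by (auto simp: continuous_within intro: tendsto_eventually)
  qed
  have *: "increment_measure (interval_measure F) F"
    if "\<And>x y. x \<le> y \<Longrightarrow> F x \<le> F y" "\<And>s. continuous (at_right s) F" for F
    unfolding increment_measure_def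
    using that by (auto intro!: mono_onI emeasure_interval_measure_Ioc)
  have mono: "\<bar>g (max 0 y) - g (max 0 x)\<bar> \<le> variation g (max 0 y) - variation g (max 0 x)"
    if "x \<le> y" for x y
    using that by (intro abs_diff_le_variation_diff[OF bv]) auto
  show "increment_measure (interval_measure (jordan_pos g)) (jordan_pos g)"
  proof (rule *)
    show "jordan_pos g x \<le> jordan_pos g y" if "x \<le> y" for x y
      using mono[OF that] by (auto simp: jordan_pos_def intro!: divide_right_mono)
    show "continuous (at_right s) (jordan_pos g)" for s
      unfolding jordan_pos_def
      by (intro continuous_intros cont rc variation_right_continuous[OF bv]) auto
  qed
  show "increment_measure (interval_measure (jordan_neg g)) (jordan_neg g)"
  proof (rule *)
    show "jordan_neg g x \<le> jordan_neg g y" if "x \<le> y" for x y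
      using mono[OF that] by (auto simp: jordan_neg_def intro!: divide_right_mono)
    show "continuous (at_right s) (jordan_neg g)" for s
      unfolding jordan_neg_def
      by (intro continuous_intros cont rc variation_right_continuous[OF bv]) auto
  qed
qed

text \<open>The sums are linear in the integrator and \<open>g\<close> is the difference of its
  Jordan parts, so the variation function cancels from the approximations. Measurability of the
  integral in the scenario can therefore be read off from values of \<open>g\<close> alone.\<close>

lemma left_sum_tendsto_stieltjes_integral:
  assumes bv: "locally_bounded_variation g"
    and rc: "\<And>s. 0 \<le> s \<Longrightarrow> (g \<longlongrightarrow> g s) (at_right s)"
    and "0 \<le> t"
    and lim: "\<And>s. 0 < s \<Longrightarrow> s \<le> t \<Longrightarrow> (X \<longlongrightarrow> f s) (at_left s)"
    and bound: "\<And>s. 0 \<le> s \<Longrightarrow> s < t \<Longrightarrow> \<bar>X s\<bar> \<le> K"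
  shows "left_sum X g 0 t \<longlonglongrightarrow> stieltjes_integral f g t"
proof -
  have "left_sum X g 0 t = (\<lambda>m. left_sum X (jordan_pos g) 0 t m - left_sum X (jordan_neg g) 0 t m)"
  proof
    fix m
    have g: "g (grid 0 t (Suc m) i) =
        jordan_pos g (grid 0 t (Suc m) i) - jordan_neg g (grid 0 t (Suc m) i)" for i
      using grid_ge[of 0 t "Suc m" i] \<open>0 \<le> t\<close>
      by (simp add: jordan_pos_def jordan_neg_def max_def field_simps)
    show "left_sum X g 0 t m = left_sum X (jordan_pos g) 0 t m - left_sum X (jordan_neg g) 0 t m"
      unfolding left_sum_def sum_subtractf[symmetric] g
      by (intro sum.cong refl) (simp add: algebra_simps)
  qed
  moreover have "(\<lambda>m. left_sum X (jordan_pos g) 0 t m - left_sum X (jordan_neg g) 0 t m)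
      \<longlonglongrightarrow> stieltjes_integral f g t"
    unfolding stieltjes_integral_eq
    by (intro tendsto_diff left_sum_tendsto[where K = K] increment_measure_jordan[OF bv rc] order_refl \<open>0 \<le> t\<close>
        lim bound)
  ultimately show ?thesis by simp
qed


section \<open>Paths with left limits\<close>

lemma left_lim_eqI:
  assumes "(f \<longlongrightarrow> l) (at_left t)"
  shows "left_lim f t = l"
  unfolding left_lim_def using assms by (intro tendsto_Lim) simp_all

lemma cadlag_left_lim:
  assumes "cadlag_on_before T f" "0 < t" "ennreal t < T"
  shows "(f \<longlongrightarrow> left_lim f t) (at_left t)"
proof -
  obtain l where "(f \<longlongrightarrow> l) (at_left t)"
    using assms unfolding cadlag_on_before_def by (meson less_imp_le)
  with left_lim_eqI[OF this] show ?thesis by simp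
qed

lemma cadlag_at_right:
  assumes "cadlag_on_before T f" "0 \<le> t" "ennreal t < T"
  shows "(f \<longlongrightarrow> f t) (at_right t)"
  using assms unfolding cadlag_on_before_def continuous_within by blast

lemma cadlag_on_beforeI:
  assumes "\<And>t. 0 \<le> t \<Longrightarrow> ennreal t < T \<Longrightarrow> (f \<longlongrightarrow> f t) (at_right t)"
    and "\<And>t. 0 < t \<Longrightarrow> ennreal t < T \<Longrightarrow> (f \<longlongrightarrow> l t) (at_left t)"
  shows "cadlag_on_before T f"
  using assms unfolding cadlag_on_before_def continuous_within by blast

lemma cadlag_on_before_mono:
  "cadlag_on_before T f \<Longrightarrow> T' \<le> T \<Longrightarrow> cadlag_on_before T' f"
  unfolding cadlag_on_before_def by (meson order_less_le_trans)

text \<open>Compactness by bisection: near each point the path is bounded on the right by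
  right-continuity and on the left by the existence of the left limit.\<close>

lemma cadlag_bounded:
  assumes "cadlag_on_before T f" "0 \<le> t" "ennreal t < T"
  obtains K where "\<And>s. 0 \<le> s \<Longrightarrow> s \<le> t \<Longrightarrow> \<bar>f s\<bar> \<le> K" "0 < K"
proof -
  define P where "P a b \<longleftrightarrow> (\<exists>K. \<forall>s\<in>{a..b}. 0 \<le> s \<longrightarrow> s \<le> t \<longrightarrow> \<bar>f s\<bar> \<le> K)" for a b
  have "P 0 t"
    using \<open>0 \<le> t\<close>
  proof (induction rule: Bolzano)
    case (trans a b c)
    then obtain K L where "\<forall>s\<in>{a..b}. 0 \<le> s \<longrightarrow> s \<le> t \<longrightarrow> \<bar>f s\<bar> \<le> K"
        "\<forall>s\<in>{b..c}. 0 \<le> s \<longrightarrow> s \<le> t \<longrightarrow> \<bar>f s\<bar> \<le> L" by (auto simp: P_def)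
    then have "\<forall>s\<in>{a..c}. 0 \<le> s \<longrightarrow> s \<le> t \<longrightarrow> \<bar>f s\<bar> \<le> max K L"
      by (metis atLeastAtMost_iff le_max_iff_disj linorder_le_cases)
    then show ?case unfolding P_def by blast
  next
    case (local x)
    then have x: "0 \<le> x" "x \<le> t" by auto
    then have "ennreal x < T" using assms(3) by (meson ennreal_leI order_le_less_trans)
    have "eventually (\<lambda>y. \<bar>f y\<bar> < \<bar>f x\<bar> + 1) (at_right x)"
      using cadlag_at_right[OF assms(1) x(1) \<open>ennreal x < T\<close>]
      by (intro order_tendstoD(2)[where y = "\<bar>f x\<bar>"] tendsto_rabs) auto
    then obtain b where b: "b > x" "\<And>y. x < y \<Longrightarrow> y < b \<Longrightarrow> \<bar>f y\<bar> < \<bar>f x\<bar> + 1"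
      by (auto simp: eventually_at_right_field)
    obtain a L where a: "a < x" "\<And>y. a < y \<Longrightarrow> y < x \<Longrightarrow> 0 \<le> y \<Longrightarrow> \<bar>f y\<bar> < L"
    \<comment> \<open>At 0 there is no left limit, but also no earlier time at which a bound is
      required, so any \<open>a < 0\<close> and any \<open>L\<close> will do.\<close>
    proof (cases "x = 0")
      case True
      with that[of "-1" 0] show ?thesis by auto
    next
      case False
      with x have "0 < x" by simp
      have "eventually (\<lambda>y. \<bar>f y\<bar> < \<bar>left_lim f x\<bar> + 1) (at_left x)"
        using cadlag_left_lim[OF assms(1) \<open>0 < x\<close> \<open>ennreal x < T\<close>]
        by (intro order_tendstoD(2)[where y = "\<bar>left_lim f x\<bar>"] tendsto_rabs) auto
      then show ?thesis using that by (auto simp: eventually_at_left_field)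
    qed
    have "P u v" if "u \<le> x" "x \<le> v" "v - u < min (b - x) (x - a)" for u v
      unfolding P_def
    proof (intro exI ballI impI)
      fix s assume "s \<in> {u..v}" "0 \<le> s" "s \<le> t"
      with that have "a < s" "s < b" by auto
      then show "\<bar>f s\<bar> \<le> max L (\<bar>f x\<bar> + 1)"
        using a(2)[of s] b(2)[of s] \<open>0 \<le> s\<close> by (cases s x rule: linorder_cases) auto
    qed
    then show ?case using a(1) b(1) by (intro exI[of _ "min (b - x) (x - a)"]) auto
  qed
  then obtain K where K: "\<bar>f s\<bar> \<le> K" if "0 \<le> s" "s \<le> t" for s unfolding P_def by force
  show thesis
  proof (rule that)
    show "\<bar>f s\<bar> \<le> max K 1" if "0 \<le> s" "s \<le> t" for s using K[OF that] by simp
  qed simp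
qed


section \<open>Linear equations driven by finitely many increasing paths\<close>

lemma ennreal_less_imp_exists_greater:
  assumes "ennreal t < T" "0 \<le> t"
  obtains b where "t < b" "ennreal b < T"
proof -
  obtain z where z: "ennreal t < z" "z < T" using dense[OF assms(1)] by blast
  then obtain b where "0 \<le> b" "z = ennreal b" by (cases z) auto
  with z that[of b] show thesis using assms(2) by (simp add: ennreal_less_iff)
qed

lemma ennreal_less_mono: "ennreal t < T \<Longrightarrow> s \<le> t \<Longrightarrow> ennreal s < T"
  by (meson ennreal_leI order_le_less_trans)

lemma geometric_increments:
  fixes a :: "nat \<Rightarrow> real"
  assumes "\<And>n. \<bar>a (Suc n) - a n\<bar> \<le> C / 2 ^ n"
  shows "convergent a" and "\<bar>a n\<bar> \<le> \<bar>a 0\<bar> + 2 * C"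
proof -
  have s: "summable (\<lambda>n. C / 2 ^ n)"
    using summable_mult[OF summable_geometric[of "1/2 :: real"], of C] by (simp add: power_divide)
  then have "summable (\<lambda>n. a (Suc n) - a n)"
    by (rule summable_comparison_test') (use assms in auto)
  then have "convergent (\<lambda>n. \<Sum>i<n. a (Suc i) - a i)" by (simp add: summable_iff_convergent)
  then have "convergent (\<lambda>n. a n - a 0)" by (simp only: sum_lessThan_telescope)
  from convergent_add[OF this convergent_const[of "a 0"]] show "convergent a" by simp
  have "0 \<le> C" using assms[of 0] by simp
  \<comment> \<open>The bound is the exact partial sum of the geometric series; the weaker bound
    \<open>2 * C\<close> would not survive the induction step.\<close>
  have "\<bar>a n - a 0\<bar> \<le> 2 * C * (1 - 1 / 2 ^ n)" for n
  proof (induction n)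
    case (Suc n)
    have "\<bar>a (Suc n) - a 0\<bar> \<le> \<bar>a (Suc n) - a n\<bar> + \<bar>a n - a 0\<bar>" by simp
    also have "\<dots> \<le> C / 2 ^ n + 2 * C * (1 - 1 / 2 ^ n)" by (intro add_mono assms Suc)
    also have "\<dots> = 2 * C * (1 - 1 / 2 ^ Suc n)" by (simp add: field_simps)
    finally show ?case .
  qed simp
  also have "2 * C * (1 - 1 / 2 ^ n) \<le> 2 * C * 1"
    using \<open>0 \<le> C\<close> by (intro mult_left_mono) auto
  finally show "\<bar>a n\<bar> \<le> \<bar>a 0\<bar> + 2 * C" by simp
qed

lemma mono_on_left_lim:
  fixes f :: "real \<Rightarrow> real"
  assumes "mono_on {0..} f" "0 < s"
  shows "(f \<longlongrightarrow> left_lim f s) (at_left s)"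
proof -
  define L where "L = (SUP x\<in>{0..<s}. f x)"
  have bdd: "bdd_above (f ` {0..<s})"
    using assms by (intro bdd_aboveI2[where M = "f s"] mono_onD[OF assms(1)]) auto
  have "(f \<longlongrightarrow> L) (at_left s)"
  proof (rule increasing_tendsto)
    show "eventually (\<lambda>x. f x \<le> L) (at_left s)"
      using eventually_at_left_real[OF assms(2)]
      by eventually_elim (auto simp: L_def intro!: cSUP_upper bdd)
    fix l assume "l < L"
    then obtain x where x: "x \<in> {0..<s}" "l < f x"
      using less_cSUP_iff[OF _ bdd, of l] assms(2) by (auto simp: L_def)
    have "l < f u" if "u \<in> {x<..<s}" for u
      using x mono_onD[OF assms(1), of x u] that by auto
    with x show "eventually (\<lambda>x. l < f x) (at_left s)"
      by (intro eventually_mono[OF eventually_at_left_real[of x s]]) auto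
  qed
  with left_lim_eqI[OF this] show ?thesis by simp
qed

text \<open>The integrands for which all integrals before the lifetime \<open>T\<close> make sense.
  Nothing is asked at 0 or from \<open>T\<close> on, where \<open>left_lim\<close> of a solution may
  be an arbitrary value.\<close>

definition admissible :: "ennreal \<Rightarrow> (real \<Rightarrow> real) \<Rightarrow> bool" where
  "admissible T y \<longleftrightarrow> (\<forall>t\<ge>0. ennreal t < T \<longrightarrow>
     (\<lambda>s. indicator {0<..t} s * y s) \<in> borel_measurable borel \<and> (\<exists>K. \<forall>s\<in>{0<..t}. \<bar>y s\<bar> \<le> K))"

lemma admissible_left_limit:
  assumes x: "cadlag_on_before T x"
    and lim: "\<And>s. 0 < s \<Longrightarrow> ennreal s < T \<Longrightarrow> (x \<longlongrightarrow> y s) (at_left s)"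
  shows "admissible T y"
  unfolding admissible_def
proof (intro allI impI conjI)
  fix t assume t: "0 \<le> t" "ennreal t < T"
  have lim: "(x \<longlongrightarrow> y s) (at_left s)" if "0 < s" "s \<le> t" for s
    using that t ennreal_less_mono by (intro lim) auto
  then show "(\<lambda>s. indicator {0<..t} s * y s) \<in> borel_measurable borel"
    by (rule borel_measurable_left_limit)
  obtain K where K: "\<And>s. 0 \<le> s \<Longrightarrow> s \<le> t \<Longrightarrow> \<bar>x s\<bar> \<le> K"
    using cadlag_bounded[OF x t] by blast
  have "\<bar>y s\<bar> \<le> K" if "s \<in> {0<..t}" for s
  proof (rule tendsto_upperbound)
    show "((\<lambda>u. \<bar>x u\<bar>) \<longlongrightarrow> \<bar>y s\<bar>) (at_left s)"
      using that by (intro tendsto_rabs lim) auto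
    show "eventually (\<lambda>u. \<bar>x u\<bar> \<le> K) (at_left s)"
      using eventually_at_left_real[of 0 s] that by (auto elim!: eventually_mono intro!: K)
  qed simp
  then show "\<exists>K. \<forall>s\<in>{0<..t}. \<bar>y s\<bar> \<le> K" by blast
qed

lemma admissible_left_lim: "cadlag_on_before T x \<Longrightarrow> admissible T (left_lim x)"
  by (rule admissible_left_limit[OF _ cadlag_left_lim])

lemma admissible_diff:
  assumes "admissible T y" "admissible T z"
  shows "admissible T (\<lambda>s. y s - z s)"
  unfolding admissible_def
proof (intro allI impI conjI)
  fix t assume t: "0 \<le> t" "ennreal t < T"
  have "(\<lambda>s. indicator {0<..t} s * y s - indicator {0<..t} s * z s) \<in> borel_measurable borel"
    using assms t by (intro borel_measurable_diff) (auto simp: admissible_def)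
  then show "(\<lambda>s. indicator {0<..t} s * (y s - z s)) \<in> borel_measurable borel"
    by (simp add: right_diff_distrib)
  obtain K L where "\<forall>s\<in>{0<..t}. \<bar>y s\<bar> \<le> K" "\<forall>s\<in>{0<..t}. \<bar>z s\<bar> \<le> L"
    using assms t unfolding admissible_def by blast
  then have "\<forall>s\<in>{0<..t}. \<bar>y s - z s\<bar> \<le> K + L"
    by (meson abs_triangle_ineq4 add_mono order_trans)
  then show "\<exists>K. \<forall>s\<in>{0<..t}. \<bar>y s - z s\<bar> \<le> K" by blast
qed

text \<open>One scenario, stripped of probability, with the equation
  \<open>x t = x\<^sub>0 + J {0<..t} (left_lim x)\<close>. A signed integrator enters as two
  increasing ones with opposite coefficients, so that a single weight controls all of them.\<close>

locale linear_stieltjes =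
  fixes I :: "'i set" and \<mu> :: "'i \<Rightarrow> real measure" and g c :: "'i \<Rightarrow> real \<Rightarrow> real" and T :: ennreal
  assumes finite_I: "finite I"
    and increments: "i \<in> I \<Longrightarrow> increment_measure (\<mu> i) (g i)"
    and c_admissible: "i \<in> I \<Longrightarrow> admissible T (c i)"
begin

lemma c_borel:
  assumes "i \<in> I" "0 \<le> t" "ennreal t < T"
  shows "(\<lambda>s. indicator {0<..t} s * c i s) \<in> borel_measurable borel"
  using c_admissible assms unfolding admissible_def by blast

lemma c_bounded:
  assumes "i \<in> I" "0 \<le> t" "ennreal t < T"
  shows "\<exists>K. \<forall>s\<in>{0<..t}. \<bar>c i s\<bar> \<le> K"
  using c_admissible assms unfolding admissible_def by blast

lemma c_bound_exists:
  assumes "0 \<le> t" "ennreal t < T"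
  obtains K where "K > 0" "\<And>i s. i \<in> I \<Longrightarrow> s \<in> {0<..t} \<Longrightarrow> \<bar>c i s\<bar> \<le> K"
proof -
  obtain k where k: "\<And>i s. i \<in> I \<Longrightarrow> s \<in> {0<..t} \<Longrightarrow> \<bar>c i s\<bar> \<le> k i"
    using c_bounded[OF _ assms] by metis
  have "\<bar>c i s\<bar> \<le> (\<Sum>i\<in>I. \<bar>k i\<bar>) + 1" if "i \<in> I" "s \<in> {0<..t}" for i s
    using k[OF that] member_le_sum[of i I "\<lambda>i. \<bar>k i\<bar>"] finite_I that by simp
  then show thesis using that[of "(\<Sum>i\<in>I. \<bar>k i\<bar>) + 1"] by (simp add: add_nonneg_pos sum_nonneg)
qed

section \<open>The integral operator and its one-sided limits in time\<close>

definition J :: "real set \<Rightarrow> (real \<Rightarrow> real) \<Rightarrow> real" where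
  "J A y = (\<Sum>i\<in>I. LINT s:A|\<mu> i. y s * c i s)"

lemma J_empty [simp]: "J {} y = 0"
  by (simp add: J_def set_lebesgue_integral_def)

lemma J_cong: "(\<And>s. s \<in> A \<Longrightarrow> y s = z s) \<Longrightarrow> J A y = J A z"
  unfolding J_def set_lebesgue_integral_def
  by (intro sum.cong Bochner_Integration.integral_cong refl) (auto simp: indicator_def)

lemma integrable_admissible:
  assumes "admissible T y" "i \<in> I" "0 \<le> t" "ennreal t < T"
  shows "set_integrable (\<mu> i) {0<..t} (\<lambda>s. y s * c i s)"
proof -
  obtain K L where KL: "\<forall>s\<in>{0<..t}. \<bar>y s\<bar> \<le> K" "\<forall>s\<in>{0<..t}. \<bar>c i s\<bar> \<le> L"
    using assms c_bounded unfolding admissible_def by blast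
  show ?thesis
  proof (rule set_integrable_bounded[OF increments[OF assms(2)], where K = "K * L"])
    have "(\<lambda>s. indicator {0<..t} s * y s) \<in> borel_measurable borel"
      using assms by (auto simp: admissible_def)
    from borel_measurable_times[OF this c_borel[OF assms(2-4)]]
    have "(\<lambda>s. (indicator {0<..t} s * y s) * (indicator {0<..t} s * c i s)) \<in> borel_measurable borel" .
    then show "(\<lambda>s. indicator {0<..t} s * (y s * c i s)) \<in> borel_measurable borel"
      by (rule measurable_cong[THEN iffD1, rotated]) (auto simp: indicator_def)
    show "\<bar>y s * c i s\<bar> \<le> K * L" if "0 < s" "s \<le> t" for s
      unfolding abs_mult using KL that by (intro mult_mono) (auto intro: order_trans[OF abs_ge_zero])
  qed simp
qed

lemma integrable_admissible_subset:
  assumes "admissible T y" "i \<in> I" "0 \<le> t" "ennreal t < T" "A \<in> sets borel" "A \<subseteq> {0<..t}"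
  shows "set_integrable (\<mu> i) A (\<lambda>s. y s * c i s)"
  using set_integrable_subset[OF integrable_admissible[OF assms(1-4)] _ assms(6)] assms(5)
    increment_measureD(1)[OF increments[OF assms(2)]] by simp

lemma J_diff:
  assumes "admissible T y" "admissible T z" "0 \<le> t" "ennreal t < T" "A \<in> sets borel" "A \<subseteq> {0<..t}"
  shows "J A y - J A z = J A (\<lambda>s. y s - z s)"
  unfolding J_def sum_subtractf[symmetric]
proof (intro sum.cong refl)
  fix i assume "i \<in> I"
  from set_integral_diff(2)[OF integrable_admissible_subset[OF assms(1) this assms(3-)]
      integrable_admissible_subset[OF assms(2) this assms(3-)]]
  show "(LINT s:A|\<mu> i. y s * c i s) - (LINT s:A|\<mu> i. z s * c i s)
      = (LINT s:A|\<mu> i. (y s - z s) * c i s)"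
    by (simp add: left_diff_distrib)
qed

lemma J_interval_diff:
  assumes "admissible T y" "0 \<le> s" "s \<le> t" "ennreal t < T"
  shows "J {0<..t} y - J {0<..s} y = J {s<..t} y"
proof -
  have "J {0<..t} y = J {0<..s} y + J {s<..t} y"
    unfolding J_def sum.distrib[symmetric]
  proof (intro sum.cong refl)
    fix i assume i: "i \<in> I"
    have "{0<..t} = {0<..s} \<union> {s<..t}" using assms by auto
    then show "(LINT s:{0<..t}|\<mu> i. y s * c i s)
        = (LINT s:{0<..s}|\<mu> i. y s * c i s) + (LINT s:{s<..t}|\<mu> i. y s * c i s)"
      using assms
      by (auto intro!: set_integral_Un integrable_admissible_subset[OF assms(1) i _ assms(4)])
  qed
  then show ?thesis by simp
qed

text \<open>Domains and integrands vary together, so that one statement covers both the limits in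
  the time variable and the limit of the Picard iterates.\<close>

lemma J_dominated_convergence:
  assumes t: "0 \<le> t" "ennreal t < T"
    and borel: "\<And>n. (\<lambda>s. indicator {0<..t} s * y n s) \<in> borel_measurable borel"
    and bound: "\<And>n s. s \<in> {0<..t} \<Longrightarrow> \<bar>y n s\<bar> \<le> K"
    and A: "\<And>n. A n \<in> sets borel" "\<And>n. A n \<subseteq> {0<..t}" "B \<subseteq> {0<..t}"
    and lim: "\<And>s. s \<in> {0<..t} \<Longrightarrow> (\<lambda>n. indicator (A n) s * y n s) \<longlonglongrightarrow> indicator B s * z s"
  shows "(\<lambda>n. J (A n) (y n)) \<longlonglongrightarrow> J B z"
  unfolding J_def
proof (intro tendsto_sum)
  fix i assume i: "i \<in> I"
  note [measurable_cong] = increment_measureD(1)[OF increments[OF i]]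
  obtain L where L: "\<forall>s\<in>{0<..t}. \<bar>c i s\<bar> \<le> L" using c_bounded[OF i t] by blast
  have meas: "(\<lambda>s. indicat_real (A n) s *\<^sub>R (y n s * c i s)) \<in> borel_measurable borel" for n
  proof -
    have "(\<lambda>s. indicat_real (A n) s * (indicator {0<..t} s * y n s) * (indicator {0<..t} s * c i s))
        \<in> borel_measurable borel"
      using A(1) by (intro borel_measurable_times borel c_borel i t borel_measurable_indicator)
    also have "(\<lambda>s. indicat_real (A n) s * (indicator {0<..t} s * y n s) * (indicator {0<..t} s * c i s))
        = (\<lambda>s. indicat_real (A n) s *\<^sub>R (y n s * c i s))"
      using A(2)[of n] by (auto simp: indicator_def fun_eq_iff)
    finally show ?thesis .
  qed
  have conv: "(\<lambda>n. indicat_real (A n) s *\<^sub>R (y n s * c i s)) \<longlonglongrightarrow> indicat_real B s *\<^sub>R (z s * c i s)" for s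
  proof (cases "s \<in> {0<..t}")
    case True
    from tendsto_mult_right[OF lim[OF True], of "c i s"] show ?thesis by (simp add: mult.assoc)
  next
    case False
    then have "indicat_real (A n) s = 0" "indicat_real B s = 0" for n
      using A(2)[of n] A(3) by (auto simp: indicator_def)
    then show ?thesis by simp
  qed
  show "(\<lambda>n. LINT s:A n|\<mu> i. y n s * c i s) \<longlonglongrightarrow> (LINT s:B|\<mu> i. z s * c i s)"
    unfolding set_lebesgue_integral_def
  proof (rule integral_dominated_convergence[where w = "\<lambda>s. K * L * indicator {0<..t} s"])
    show "(\<lambda>s. indicat_real B s *\<^sub>R (z s * c i s)) \<in> borel_measurable (\<mu> i)"
      using borel_measurable_LIMSEQ_real[OF conv meas] by simp
    show "(\<lambda>s. indicat_real (A n) s *\<^sub>R (y n s * c i s)) \<in> borel_measurable (\<mu> i)" for n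
      using meas by simp
    show "integrable (\<mu> i) (\<lambda>s. K * L * indicator {0<..t} s)"
      using increment_measureD(4)[OF increments[OF i], of 0 t] t(1)
      by (intro integrable_mult_right integrable_real_indicator) auto
    show "AE s in \<mu> i. norm (indicat_real (A n) s *\<^sub>R (y n s * c i s)) \<le> K * L * indicator {0<..t} s" for n
    proof (intro AE_I2)
      fix s
      show "norm (indicat_real (A n) s *\<^sub>R (y n s * c i s)) \<le> K * L * indicator {0<..t} s"
      proof (cases "s \<in> {0<..t}")
        case True
        have "\<bar>y n s\<bar> * \<bar>c i s\<bar> \<le> K * L"
          using True L bound[OF True] by (intro mult_mono) (auto intro: order_trans[OF abs_ge_zero])
        moreover from this have "0 \<le> K * L" by (rule order_trans[rotated]) simp
        ultimately show ?thesis using True by (auto simp: abs_mult indicator_def)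
      next
        case False
        then show ?thesis using A(2)[of n] by (auto simp: indicator_def)
      qed
    qed
  qed (use conv in auto)
qed

text \<open>The intervals \<open>{0<..u}\<close> increase to \<open>{0<..<t}\<close>, so atoms of
  the measures at \<open>t\<close> are lost in the limit; they form the jump of the integral at
  \<open>t\<close>.\<close>

lemma J_left_limit:
  assumes y: "admissible T y" and t: "0 < t" "ennreal t < T"
  shows "((\<lambda>u. J {0<..u} y) \<longlongrightarrow> J {0<..<t} y) (at_left t)"
proof (rule tendsto_at_left_sequentially[OF t(1)])
  fix S :: "nat \<Rightarrow> real"
  assume S: "\<And>n. S n < t" "\<And>n. 0 < S n" "incseq S" "S \<longlonglongrightarrow> t"
  obtain K where K: "\<And>s. s \<in> {0<..t} \<Longrightarrow> \<bar>y s\<bar> \<le> K"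
    using y t unfolding admissible_def by (meson less_imp_le)
  show "(\<lambda>n. J {0<..S n} y) \<longlonglongrightarrow> J {0<..<t} y"
  proof (rule J_dominated_convergence[where t = t and K = K])
    fix s assume s: "s \<in> {0<..t}"
    show "(\<lambda>n. indicator {0<..S n} s * y s) \<longlonglongrightarrow> indicator {0<..<t} s * y s"
    proof (cases "s < t")
      case True
      have "eventually (\<lambda>n. s < S n) sequentially" using S(4) True by (rule order_tendstoD)
      then have "eventually (\<lambda>n. indicator {0<..S n} s * y s = indicator {0<..<t} s * y s) sequentially"
        by (rule eventually_mono) (use s True in \<open>auto simp: indicator_def\<close>)
      then show ?thesis by (rule tendsto_eventually)
    next
      case False
      then have "indicator {0<..S n} s = (0 :: real)" for n using S(1)[of n] by (auto simp: indicator_def)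
      with False show ?thesis by simp
    qed
  next
    show "{0<..S n} \<subseteq> {0<..t}" for n using S(1)[of n] by auto
  qed (use y t K in \<open>auto simp: admissible_def\<close>)
qed

lemma J_right_continuous:
  assumes y: "admissible T y" and t: "0 \<le> t" "ennreal t < T"
  shows "((\<lambda>u. J {0<..u} y) \<longlongrightarrow> J {0<..t} y) (at_right t)"
proof -
  obtain b where b: "t < b" "ennreal b < T" using ennreal_less_imp_exists_greater[OF t(2,1)] by blast
  show ?thesis
  proof (rule tendsto_at_right_sequentially[OF b(1)])
    fix S :: "nat \<Rightarrow> real"
    assume S: "\<And>n. t < S n" "\<And>n. S n < b" "decseq S" "S \<longlonglongrightarrow> t"
    have "0 \<le> b" using t b by simp
    then obtain K where K: "\<And>s. s \<in> {0<..b} \<Longrightarrow> \<bar>y s\<bar> \<le> K"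
      using y b unfolding admissible_def by meson
    show "(\<lambda>n. J {0<..S n} y) \<longlonglongrightarrow> J {0<..t} y"
    proof (rule J_dominated_convergence[where t = b and K = K])
      fix s assume s: "s \<in> {0<..b}"
      show "(\<lambda>n. indicator {0<..S n} s * y s) \<longlonglongrightarrow> indicator {0<..t} s * y s"
      proof (cases "t < s")
        case True
        have "eventually (\<lambda>n. S n < s) sequentially" using S(4) True by (rule order_tendstoD)
        then have "eventually (\<lambda>n. indicator {0<..S n} s * y s = indicator {0<..t} s * y s) sequentially"
          by (rule eventually_mono) (use t(1) True in \<open>auto simp: indicator_def\<close>)
        then show ?thesis by (rule tendsto_eventually)
      next
        case False
        then have "indicator {0<..S n} s = (indicator {0<..t} s :: real)" for n
          using S(1)[of n] by (auto simp: indicator_def)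
        then show ?thesis by simp
      qed
    next
      show "{0<..S n} \<subseteq> {0<..b}" for n using S(2)[of n] by auto
    qed (use y t b K \<open>0 \<le> b\<close> in \<open>auto simp: admissible_def\<close>)
  qed
qed

lemma cadlag_J:
  assumes "admissible T y"
  shows "cadlag_on_before T (\<lambda>t. x\<^sub>0 + J {0<..t} y)"
  using assms
  by (intro cadlag_on_beforeI[where l = "\<lambda>t. x\<^sub>0 + J {0<..<t} y"] tendsto_add tendsto_const
      J_left_limit J_right_continuous)

text \<open>
  The weight compensates jumps of any size: \<open>\<lambda> exp (\<lambda> a) (b - a) \<le> exp (\<lambda> b) - exp (\<lambda> a)\<close> makes the
  integral operator contractive in the norm \<open>sup \<bar>x\<bar> / weight \<lambda>\<close> as soon as \<open>\<lambda>\<close> is large.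
\<close>

definition weight :: "real \<Rightarrow> real \<Rightarrow> real" where
  "weight l t = exp (l * (\<Sum>i\<in>I. g i t))"

lemma weight_pos: "0 < weight l t"
  by (simp add: weight_def)

lemma weight_mono: "0 \<le> l \<Longrightarrow> mono_on {0..} (weight l)"
  unfolding weight_def
  by (intro mono_onI) (auto intro!: mult_left_mono sum_mono increment_measureD(3)[OF increments])

lemma weight_left_lim:
  "0 \<le> l \<Longrightarrow> 0 < s \<Longrightarrow> (weight l \<longlongrightarrow> left_lim (weight l) s) (at_left s)"
  by (intro mono_on_left_lim weight_mono)

lemma weight_left_lim_le:
  assumes "0 \<le> l" "0 < s" "s \<le> t"
  shows "left_lim (weight l) s \<le> weight l t"
proof (rule tendsto_upperbound[OF weight_left_lim[OF assms(1,2)]])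
  show "eventually (\<lambda>u. weight l u \<le> weight l t) (at_left s)"
    using eventually_at_left_real[OF assms(2)] assms
    by (auto elim!: eventually_mono intro!: mono_onD[OF weight_mono])
qed simp

lemma weight_left_lim_nonneg:
  assumes "0 \<le> l" "0 < s"
  shows "0 \<le> left_lim (weight l) s"
  by (rule tendsto_lowerbound[OF weight_left_lim[OF assms]]) (auto intro!: always_eventually less_imp_le weight_pos)

lemma integrable_weight:
  assumes "0 \<le> l" "0 \<le> s" "i \<in> I"
  shows "set_integrable (\<mu> i) {s<..t} (left_lim (weight l))"
proof (rule set_integrable_bounded[OF increments[OF assms(3)] assms(2), where K = "weight l t"])
  show "(\<lambda>u. indicat_real {s<..t} u * left_lim (weight l) u) \<in> borel_measurable borel"
    using assms by (intro borel_measurable_left_limit[where X = "weight l"] weight_left_lim) auto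
  show "\<bar>left_lim (weight l) u\<bar> \<le> weight l t" if "s < u" "u \<le> t" for u
    using weight_left_lim_le[of l u t] weight_left_lim_nonneg[of l u] assms that by simp
qed

text \<open>Summing over \<open>i\<close> first turns the left sums into a telescope: the exponent
  of the weight is the total of all integrators, and \<open>1 + x \<le> exp x\<close> with
  \<open>x = l * (b - a)\<close> bounds each cell. Left endpoints are essential, since with values
  at right endpoints the inequality for a cell would be reversed.\<close>

lemma integral_weight_le:
  assumes "0 < l" "0 \<le> s" "s \<le> t"
  shows "(\<Sum>i\<in>I. LINT u:{s<..t}|\<mu> i. left_lim (weight l) u) \<le> (weight l t - weight l s) / l"
proof (rule LIMSEQ_le_const2)
  show "(\<lambda>m. \<Sum>i\<in>I. left_sum (weight l) (g i) s t m)
      \<longlonglongrightarrow> (\<Sum>i\<in>I. LINT u:{s<..t}|\<mu> i. left_lim (weight l) u)"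
    using assms mono_onD[OF weight_mono[of l]] weight_pos
    by (intro tendsto_sum left_sum_tendsto[where K = "weight l t"] increments weight_left_lim)
      (auto simp: less_imp_le)
  have "(\<Sum>i\<in>I. left_sum (weight l) (g i) s t m) \<le> (weight l t - weight l s) / l" for m
  proof -
    let ?p = "grid s t (Suc m)"
    have "(\<Sum>i\<in>I. left_sum (weight l) (g i) s t m)
        = (\<Sum>j<Suc m. weight l (?p j) * ((\<Sum>i\<in>I. g i (?p (Suc j))) - (\<Sum>i\<in>I. g i (?p j))))"
      unfolding left_sum_def by (subst sum.swap) (simp only: sum_distrib_left sum_subtractf[symmetric])
    also have "\<dots> \<le> (\<Sum>j<Suc m. (weight l (?p (Suc j)) - weight l (?p j)) / l)"
    proof (rule sum_mono)
      fix j
      have *: "exp (l * a) * (b - a) \<le> (exp (l * b) - exp (l * a)) / l" for a b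
      proof -
        have "exp (l * a) * (1 + l * (b - a)) \<le> exp (l * a) * exp (l * (b - a))"
          by (intro mult_left_mono exp_ge_add_one_self) simp
        also have "\<dots> = exp (l * b)" by (simp add: exp_add[symmetric] algebra_simps)
        finally show ?thesis using assms(1) by (simp add: field_simps)
      qed
      show "weight l (?p j) * ((\<Sum>i\<in>I. g i (?p (Suc j))) - (\<Sum>i\<in>I. g i (?p j)))
          \<le> (weight l (?p (Suc j)) - weight l (?p j)) / l"
        unfolding weight_def by (rule *)
    qed
    also have "\<dots> = (weight l t - weight l s) / l"
      unfolding sum_divide_distrib[symmetric]
      by (subst sum_lessThan_telescope) simp
    finally show ?thesis .
  qed
  then show "\<exists>N. \<forall>m\<ge>N. (\<Sum>i\<in>I. left_sum (weight l) (g i) s t m) \<le> (weight l t - weight l s) / l"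
    by blast
qed

text \<open>The coefficients contribute a factor \<open>K\<close> and the integral of the weight a
  factor \<open>1 / (2 * K)\<close>; the rate \<open>2 * K\<close> is chosen to make the product
  \<open>1 / 2\<close>. A bound by left limits of the weight is turned into one by its values, and
  \<open>left_lim_weight_bound\<close> leads back, so the step can be iterated.\<close>

lemma J_contraction:
  assumes y: "admissible T y" and st: "0 \<le> s" "s \<le> t" "ennreal t < T"
    and K: "0 < K" "\<And>i u. i \<in> I \<Longrightarrow> u \<in> {0<..t} \<Longrightarrow> \<bar>c i u\<bar> \<le> K"
    and "0 \<le> D"
    and dom: "\<And>u. s < u \<Longrightarrow> u \<le> t \<Longrightarrow> \<bar>y u\<bar> \<le> D * left_lim (weight (2 * K)) u"
  shows "\<bar>J {s<..t} y\<bar> \<le> D / 2 * weight (2 * K) t"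
proof -
  let ?w = "weight (2 * K)"
  have "\<bar>J {s<..t} y\<bar> \<le> (\<Sum>i\<in>I. D * K * (LINT u:{s<..t}|\<mu> i. left_lim ?w u))"
    unfolding J_def
  proof (rule order_trans[OF sum_abs sum_mono])
    fix i assume i: "i \<in> I"
    have int: "set_integrable (\<mu> i) {s<..t} (\<lambda>u. y u * c i u)"
      using st by (intro integrable_admissible_subset[OF y i _ st(3)]) auto
    have "\<bar>LINT u:{s<..t}|\<mu> i. y u * c i u\<bar> \<le> (LINT u:{s<..t}|\<mu> i. \<bar>y u * c i u\<bar>)"
      using set_integral_norm_bound[OF int] by simp
    also have "\<dots> \<le> (LINT u:{s<..t}|\<mu> i. D * K * left_lim ?w u)"
    proof (rule set_integral_mono)
      show "set_integrable (\<mu> i) {s<..t} (\<lambda>u. \<bar>y u * c i u\<bar>)" by (rule set_integrable_abs[OF int])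
      show "set_integrable (\<mu> i) {s<..t} (\<lambda>u. D * K * left_lim ?w u)"
        using K(1) st i by (intro set_integrable_mult_right integrable_weight) auto
      fix u assume u: "u \<in> {s<..t}"
      have "\<bar>y u\<bar> * \<bar>c i u\<bar> \<le> (D * left_lim ?w u) * K"
        using u st K(2)[OF i, of u] dom[of u] by (intro mult_mono) (auto intro: order_trans[OF abs_ge_zero])
      then show "\<bar>y u * c i u\<bar> \<le> D * K * left_lim ?w u" by (simp add: abs_mult mult_ac)
    qed
    finally show "\<bar>LINT u:{s<..t}|\<mu> i. y u * c i u\<bar> \<le> D * K * (LINT u:{s<..t}|\<mu> i. left_lim ?w u)"
      by simp
  qed
  also have "\<dots> = D * K * (\<Sum>i\<in>I. LINT u:{s<..t}|\<mu> i. left_lim ?w u)"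
    by (simp add: sum_distrib_left)
  also have "\<dots> \<le> D * K * (?w t / (2 * K))"
  proof (rule mult_left_mono)
    have "(?w t - ?w s) / (2 * K) \<le> ?w t / (2 * K)"
      using K(1) weight_pos[of "2 * K" s] by (intro divide_right_mono) auto
    then show "(\<Sum>i\<in>I. LINT u:{s<..t}|\<mu> i. left_lim ?w u) \<le> ?w t / (2 * K)"
      using integral_weight_le[of "2 * K" s t] st K(1) by linarith
  qed (use K(1) \<open>0 \<le> D\<close> in auto)
  also have "\<dots> = D / 2 * ?w t" using K(1) by simp
  finally show ?thesis .
qed

lemma left_lim_weight_bound:
  assumes "0 \<le> l" "0 \<le> s" "s < u"
    and "(f \<longlongrightarrow> r) (at_left u)"
    and "\<And>v. s \<le> v \<Longrightarrow> v < u \<Longrightarrow> \<bar>f v\<bar> \<le> D * weight l v"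
  shows "\<bar>r\<bar> \<le> D * left_lim (weight l) u"
proof (rule tendsto_le)
  show "((\<lambda>v. D * weight l v) \<longlongrightarrow> D * left_lim (weight l) u) (at_left u)"
    using assms by (intro tendsto_intros weight_left_lim) auto
  show "((\<lambda>v. \<bar>f v\<bar>) \<longlongrightarrow> \<bar>r\<bar>) (at_left u)" by (intro tendsto_intros assms(4))
  show "eventually (\<lambda>v. \<bar>f v\<bar> \<le> D * weight l v) (at_left u)"
    using eventually_at_left_real[OF assms(3)] by eventually_elim (auto intro!: assms(5))
qed simp

text \<open>The homogeneous equation reproduces \<open>z\<close>, and each use of it halves the
  weighted bound. Only times after \<open>s\<close> enter, so \<open>z\<close> may be nonzero before
  \<open>s\<close>: the case \<open>s = 0\<close> gives uniqueness, a later \<open>s\<close> gives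
  absorption at 0.\<close>

lemma zero_absorbing:
  assumes z: "cadlag_on_before T z" and "0 \<le> s" "s \<le> t" "ennreal t < T"
    and eq: "\<And>u. s \<le> u \<Longrightarrow> u \<le> t \<Longrightarrow> z u = J {s<..u} (left_lim z)"
  shows "z t = 0"
proof -
  have "0 \<le> t" using assms by simp
  obtain K where K: "0 < K" "\<And>i u. i \<in> I \<Longrightarrow> u \<in> {0<..t} \<Longrightarrow> \<bar>c i u\<bar> \<le> K"
    using c_bound_exists[OF \<open>0 \<le> t\<close> assms(4)] by blast
  obtain B where B: "\<And>u. 0 \<le> u \<Longrightarrow> u \<le> t \<Longrightarrow> \<bar>z u\<bar> \<le> B" "0 < B"
    using cadlag_bounded[OF z \<open>0 \<le> t\<close> assms(4)] by blast
  let ?w = "weight (2 * K)"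
  \<comment> \<open>\<open>?w 0\<close> is the least value of the weight on \<open>{0..t}\<close>;
    dividing by it turns the supremum bound \<open>B\<close> into a weighted one.\<close>
  have "\<forall>u. s \<le> u \<and> u \<le> t \<longrightarrow> \<bar>z u\<bar> \<le> B / ?w 0 / 2 ^ n * ?w u" for n
  proof (induction n)
    case 0
    show ?case
    proof (intro allI impI)
      fix u assume u: "s \<le> u \<and> u \<le> t"
      have "?w 0 \<le> ?w u" using u assms K(1) by (intro mono_onD[OF weight_mono]) auto
      then have "B \<le> B / ?w 0 * ?w u" using B(2) weight_pos[of "2 * K" 0] by (simp add: field_simps)
      then show "\<bar>z u\<bar> \<le> B / ?w 0 / 2 ^ 0 * ?w u" using B(1)[of u] u assms(2) by simp
    qed
  next
    case (Suc n)
    show ?case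
    proof (intro allI impI)
      fix u assume u: "s \<le> u \<and> u \<le> t"
      have "\<bar>J {s<..u} (left_lim z)\<bar> \<le> B / ?w 0 / 2 ^ n / 2 * ?w u"
      proof (rule J_contraction[OF admissible_left_lim[OF z]])
        show "\<bar>left_lim z v\<bar> \<le> B / ?w 0 / 2 ^ n * left_lim ?w v" if "s < v" "v \<le> u" for v
          using that u K(1) assms Suc
          by (intro left_lim_weight_bound[where s = s and f = z] cadlag_left_lim[OF z])
            (auto intro: ennreal_less_mono)
      qed (use assms u K B(2) weight_pos[of "2 * K" 0] in \<open>auto intro: ennreal_less_mono\<close>)
      then show "\<bar>z u\<bar> \<le> B / ?w 0 / 2 ^ Suc n * ?w u" using eq u by (simp add: mult_ac)
    qed
  qed
  then have *: "\<bar>z t\<bar> \<le> B / ?w 0 * ?w t * (1 / 2) ^ n" for n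
    using assms by (simp add: power_divide)
  have "(\<lambda>n. B / ?w 0 * ?w t * (1 / 2) ^ n) \<longlonglongrightarrow> B / ?w 0 * ?w t * 0"
    by (intro tendsto_intros LIMSEQ_power_zero) simp
  then have "\<bar>z t\<bar> \<le> B / ?w 0 * ?w t * 0"
    by (rule LIMSEQ_le_const) (use * in blast)
  then show ?thesis by simp
qed

lemma left_lim_diff:
  assumes "cadlag_on_before T x" "cadlag_on_before T x'" "0 < s" "ennreal s < T"
  shows "left_lim (\<lambda>u. x u - x' u) s = left_lim x s - left_lim x' s"
  using assms by (intro left_lim_eqI tendsto_diff cadlag_left_lim)

lemma cadlag_diff:
  assumes "cadlag_on_before T x" "cadlag_on_before T x'"
  shows "cadlag_on_before T (\<lambda>u. x u - x' u)"
proof (rule cadlag_on_beforeI)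
  show "((\<lambda>u. x u - x' u) \<longlongrightarrow> x t - x' t) (at_right t)" if "0 \<le> t" "ennreal t < T" for t
    using that assms by (intro tendsto_diff cadlag_at_right)
  show "((\<lambda>u. x u - x' u) \<longlongrightarrow> left_lim x t - left_lim x' t) (at_left t)"
    if "0 < t" "ennreal t < T" for t
    using that assms by (intro tendsto_diff cadlag_left_lim)
qed

lemma solution_unique:
  assumes x: "cadlag_on_before T x" and x': "cadlag_on_before T x'"
    and "\<And>t. 0 \<le> t \<Longrightarrow> ennreal t < T \<Longrightarrow> x t = x\<^sub>0 + J {0<..t} (left_lim x)"
    and "\<And>t. 0 \<le> t \<Longrightarrow> ennreal t < T \<Longrightarrow> x' t = x\<^sub>0 + J {0<..t} (left_lim x')"
    and t: "0 \<le> t" "ennreal t < T"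
  shows "x t = x' t"
proof -
  have "x t - x' t = 0"
  proof (rule zero_absorbing[OF cadlag_diff[OF x x'] order_refl t])
    fix u assume u: "0 \<le> u" "u \<le> t"
    have "ennreal u < T" using u t ennreal_less_mono by blast
    then have "x u - x' u = J {0<..u} (left_lim x) - J {0<..u} (left_lim x')"
      using assms(3,4) u by simp
    also have "\<dots> = J {0<..u} (\<lambda>s. left_lim x s - left_lim x' s)"
      using u \<open>ennreal u < T\<close> by (intro J_diff[of _ _ u] admissible_left_lim x x') auto
    also have "\<dots> = J {0<..u} (left_lim (\<lambda>u. x u - x' u))"
      using ennreal_less_mono[OF \<open>ennreal u < T\<close>]
      by (intro J_cong) (auto simp: left_lim_diff[OF x x'])
    finally show "x u - x' u = J {0<..u} (left_lim (\<lambda>u. x u - x' u))" .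
  qed
  then show ?thesis by simp
qed

text \<open>Subtracting the equation at time \<open>s\<close> restarts it from the value 0, which
  leaves the homogeneous equation on \<open>{s..t}\<close>.\<close>

lemma solution_zero_absorbing:
  assumes x: "cadlag_on_before T x"
    and eq: "\<And>t. 0 \<le> t \<Longrightarrow> ennreal t < T \<Longrightarrow> x t = x\<^sub>0 + J {0<..t} (left_lim x)"
    and "0 \<le> s" "s \<le> t" "ennreal t < T" "x s = 0"
  shows "x t = 0"
proof (rule zero_absorbing[OF x assms(3-5)])
  fix u assume u: "s \<le> u" "u \<le> t"
  then have lt: "ennreal u < T" "ennreal s < T" using assms(5) ennreal_less_mono by auto
  then have "x u - x s = J {0<..u} (left_lim x) - J {0<..s} (left_lim x)"
    using eq[of u] eq[of s] u assms(3) by simp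
  then show "x u = J {s<..u} (left_lim x)"
    using J_interval_diff[OF admissible_left_lim[OF x] assms(3) u(1) lt(1)] assms(6) by simp
qed

section \<open>Picard iteration\<close>

definition picard :: "real \<Rightarrow> nat \<Rightarrow> real \<Rightarrow> real" where
  "picard x\<^sub>0 n = ((\<lambda>x t. x\<^sub>0 + J {0<..t} (left_lim x)) ^^ n) (\<lambda>_. x\<^sub>0)"

lemma picard_Suc: "picard x\<^sub>0 (Suc n) = (\<lambda>t. x\<^sub>0 + J {0<..t} (left_lim (picard x\<^sub>0 n)))"
  by (simp add: picard_def)

lemma picard_cadlag: "cadlag_on_before T (picard x\<^sub>0 n)"
proof (induction n)
  case 0
  show ?case
    unfolding picard_def by (intro cadlag_on_beforeI[where l = "\<lambda>_. x\<^sub>0"]) auto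
next
  case (Suc n)
  then show ?case unfolding picard_Suc by (intro cadlag_J admissible_left_lim)
qed

text \<open>Successive differences are halved in the weighted norm; the weight is at most its value
  at \<open>t\<close>, so the bound becomes geometric and uniform on the interval. The version for
  left limits is there because left limits, not values, are integrated.\<close>

lemma picard_increments:
  assumes t: "0 \<le> t" "ennreal t < T"
  obtains C where "\<And>n u. 0 \<le> u \<Longrightarrow> u \<le> t \<Longrightarrow> \<bar>picard x\<^sub>0 (Suc n) u - picard x\<^sub>0 n u\<bar> \<le> C / 2 ^ n"
    and "\<And>n u. 0 < u \<Longrightarrow> u \<le> t \<Longrightarrow>
      \<bar>left_lim (picard x\<^sub>0 (Suc n)) u - left_lim (picard x\<^sub>0 n) u\<bar> \<le> C / 2 ^ n"
proof -
  obtain K where K: "0 < K" "\<And>i u. i \<in> I \<Longrightarrow> u \<in> {0<..t} \<Longrightarrow> \<bar>c i u\<bar> \<le> K"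
    using c_bound_exists[OF t] by blast
  let ?x = "picard x\<^sub>0"
  let ?w = "weight (2 * K)"
  have picard_at: "?x (Suc n) u = x\<^sub>0 + J {0<..u} (left_lim (?x n))" for n u
    by (simp add: picard_Suc)
  note diff_cadlag = cadlag_diff[OF picard_cadlag picard_cadlag]
  have lt: "ennreal u < T" if "u \<le> t" for u using that t ennreal_less_mono by blast
  obtain B where B: "\<And>u. 0 \<le> u \<Longrightarrow> u \<le> t \<Longrightarrow> \<bar>?x (Suc 0) u - ?x 0 u\<bar> \<le> B" "0 < B"
    using cadlag_bounded[OF diff_cadlag t] by blast
  define D where "D = B / ?w 0"
  have "0 \<le> D" using B(2) weight_pos[of "2 * K" 0] by (simp add: D_def)
  have main: "\<forall>u. 0 \<le> u \<and> u \<le> t \<longrightarrow> \<bar>?x (Suc n) u - ?x n u\<bar> \<le> D / 2 ^ n * ?w u" for n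
  proof (induction n)
    case 0
    show ?case
    proof (intro allI impI)
      fix u assume u: "0 \<le> u \<and> u \<le> t"
      have "?w 0 \<le> ?w u" using u K(1) by (intro mono_onD[OF weight_mono]) auto
      then have "B \<le> D * ?w u"
        using B(2) weight_pos[of "2 * K" 0] by (simp add: D_def field_simps)
      then show "\<bar>?x (Suc 0) u - ?x 0 u\<bar> \<le> D / 2 ^ 0 * ?w u" using B(1)[of u] u by simp
    qed
  next
    case (Suc n)
    show ?case
    proof (intro allI impI)
      fix u assume u: "0 \<le> u \<and> u \<le> t"
      have "?x (Suc (Suc n)) u - ?x (Suc n) u
          = J {0<..u} (\<lambda>s. left_lim (?x (Suc n)) s - left_lim (?x n) s)"
        unfolding picard_at[of "Suc n" u] picard_at[of n u] add_diff_cancel_left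
        by (rule J_diff[of _ _ u]) (use u lt in \<open>auto intro!: admissible_left_lim picard_cadlag\<close>)
      also have "\<bar>\<dots>\<bar> \<le> D / 2 ^ n / 2 * ?w u"
      proof (rule J_contraction)
        show "\<bar>left_lim (?x (Suc n)) v - left_lim (?x n) v\<bar> \<le> D / 2 ^ n * left_lim ?w v"
          if "0 < v" "v \<le> u" for v
          using that u K(1) Suc lt
          by (intro left_lim_weight_bound[where s = 0 and f = "\<lambda>u. ?x (Suc n) u - ?x n u"]
              tendsto_diff cadlag_left_lim[OF picard_cadlag]) auto
      qed (use u K lt \<open>0 \<le> D\<close> in \<open>auto intro!: admissible_diff admissible_left_lim picard_cadlag\<close>)
      finally show "\<bar>?x (Suc (Suc n)) u - ?x (Suc n) u\<bar> \<le> D / 2 ^ Suc n * ?w u"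
        by (simp add: mult_ac)
    qed
  qed
  have 1: "\<bar>?x (Suc n) u - ?x n u\<bar> \<le> D * ?w t / 2 ^ n" if "0 \<le> u" "u \<le> t" for n u
  proof -
    have "?w u \<le> ?w t" using that K(1) by (intro mono_onD[OF weight_mono]) auto
    then have "D / 2 ^ n * ?w u \<le> D / 2 ^ n * ?w t" using \<open>0 \<le> D\<close> by (intro mult_left_mono) auto
    moreover have "\<bar>?x (Suc n) u - ?x n u\<bar> \<le> D / 2 ^ n * ?w u" using main that by blast
    ultimately show ?thesis by simp
  qed
  have 2: "\<bar>left_lim (?x (Suc n)) u - left_lim (?x n) u\<bar> \<le> D * ?w t / 2 ^ n" if "0 < u" "u \<le> t" for n u
  proof (rule tendsto_upperbound)
    show "((\<lambda>u. \<bar>?x (Suc n) u - ?x n u\<bar>) \<longlongrightarrow> \<bar>left_lim (?x (Suc n)) u - left_lim (?x n) u\<bar>) (at_left u)"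
      using that lt by (intro tendsto_intros cadlag_left_lim[OF picard_cadlag])
    show "eventually (\<lambda>u. \<bar>?x (Suc n) u - ?x n u\<bar> \<le> D * ?w t / 2 ^ n) (at_left u)"
      using eventually_at_left_real[OF that(1)] that(2) by (auto elim!: eventually_mono intro!: 1)
  qed simp
  from that[OF 1 2] show thesis by blast
qed

text \<open>\<open>y\<close> is the limit of the left limits of the iterates, at first not known to
  be the left limit of \<open>x x\<^sub>0\<close>. Dominated convergence yields
  \<open>x x\<^sub>0 t = x\<^sub>0 + J {0<..t} y\<close>, and also
  \<open>y s = x\<^sub>0 + J {0<..<s} y\<close> from the left limits of the iterates. Letting the
  time increase to \<open>s\<close> in the former produces the right-hand side of the latter, so
  \<open>y\<close> is the left limit and the equation closes.\<close>

theorem picard_limit_solves: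
  defines "x \<equiv> \<lambda>x\<^sub>0 t. lim (\<lambda>n. picard x\<^sub>0 n t)"
  shows "0 \<le> t \<Longrightarrow> ennreal t < T \<Longrightarrow> (\<lambda>n. picard x\<^sub>0 n t) \<longlonglongrightarrow> x x\<^sub>0 t"
    and "cadlag_on_before T (x x\<^sub>0)"
    and "0 \<le> t \<Longrightarrow> ennreal t < T \<Longrightarrow> x x\<^sub>0 t = x\<^sub>0 + J {0<..t} (left_lim (x x\<^sub>0))"
proof -
  let ?p = "picard x\<^sub>0"
  define y where "y s = lim (\<lambda>n. left_lim (?p n) s)" for s
  have p_lim: "(\<lambda>n. ?p n t) \<longlonglongrightarrow> x x\<^sub>0 t" if t: "0 \<le> t" "ennreal t < T" for t
  proof -
    obtain C where "\<And>n u. 0 \<le> u \<Longrightarrow> u \<le> t \<Longrightarrow> \<bar>?p (Suc n) u - ?p n u\<bar> \<le> C / 2 ^ n"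
      using picard_increments[OF t] by metis
    then have "convergent (\<lambda>n. ?p n t)" using t by (intro geometric_increments(1)[of _ C]) auto
    then show ?thesis by (simp add: x_def convergent_LIMSEQ_iff)
  qed
  have y: "(\<lambda>n. left_lim (?p n) s) \<longlonglongrightarrow> y s" if s: "0 < s" "ennreal s < T" for s
  proof -
    have "0 \<le> s" using s by simp
    then obtain C where "\<And>n u. 0 < u \<Longrightarrow> u \<le> s \<Longrightarrow>
        \<bar>left_lim (?p (Suc n)) u - left_lim (?p n) u\<bar> \<le> C / 2 ^ n"
      using picard_increments[OF _ s(2)] by metis
    then have "convergent (\<lambda>n. left_lim (?p n) s)"
      using s by (intro geometric_increments(1)[of _ C]) auto
    then show ?thesis by (simp add: y_def convergent_LIMSEQ_iff)
  qed
  have y_bound: "\<exists>K. \<forall>n. \<forall>s\<in>{0<..t}. \<bar>left_lim (?p n) s\<bar> \<le> K" if t: "0 \<le> t" "ennreal t < T" for t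
  proof -
    obtain C where C: "\<And>n u. 0 < u \<Longrightarrow> u \<le> t \<Longrightarrow>
        \<bar>left_lim (?p (Suc n)) u - left_lim (?p n) u\<bar> \<le> C / 2 ^ n"
      using picard_increments[OF t] by metis
    obtain L where L: "\<forall>s\<in>{0<..t}. \<bar>left_lim (?p 0) s\<bar> \<le> L"
      using admissible_left_lim[OF picard_cadlag] t unfolding admissible_def by blast
    have "\<bar>left_lim (?p n) s\<bar> \<le> L + 2 * C" if "s \<in> {0<..t}" for n s
      using geometric_increments(2)[of "\<lambda>n. left_lim (?p n) s" C n] C L that by fastforce
    then show ?thesis by blast
  qed
  have borel: "(\<lambda>s. indicator {0<..t} s * left_lim (?p n) s) \<in> borel_measurable borel"
    if "0 \<le> t" "ennreal t < T" for t n
    using admissible_left_lim[OF picard_cadlag] that unfolding admissible_def by blast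
  have "admissible T y"
    unfolding admissible_def
  proof (intro allI impI conjI)
    fix t assume t: "0 \<le> t" "ennreal t < T"
    have lt: "ennreal s < T" if "s \<le> t" for s using that t ennreal_less_mono by blast
    have "(\<lambda>n. indicator {0<..t} s * left_lim (?p n) s) \<longlonglongrightarrow> indicator {0<..t} s * y s" for s
      using y[of s] lt[of s] by (cases "s \<in> {0<..t}") auto
    then show "(\<lambda>s. indicator {0<..t} s * y s) \<in> borel_measurable borel"
      using borel[OF t] by (rule borel_measurable_LIMSEQ_real)
    obtain K where K: "\<forall>n. \<forall>s\<in>{0<..t}. \<bar>left_lim (?p n) s\<bar> \<le> K" using y_bound[OF t] by blast
    have "\<bar>y s\<bar> \<le> K" if "s \<in> {0<..t}" for s
      using K that lt by (intro LIMSEQ_le_const2[OF tendsto_rabs[OF y]]) auto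
    then show "\<exists>K. \<forall>s\<in>{0<..t}. \<bar>y s\<bar> \<le> K" by blast
  qed
  have J_lim: "(\<lambda>n. J A (left_lim (?p n))) \<longlonglongrightarrow> J A y"
    if t: "0 \<le> t" "ennreal t < T" and A: "A \<in> sets borel" "A \<subseteq> {0<..t}" for A t
  proof -
    obtain K where K: "\<forall>n. \<forall>s\<in>{0<..t}. \<bar>left_lim (?p n) s\<bar> \<le> K" using y_bound[OF t] by blast
    show ?thesis
      using K A y ennreal_less_mono[OF t(2)]
      by (intro J_dominated_convergence[OF t borel[OF t], where K = K] tendsto_intros) auto
  qed
  have x_eq: "x x\<^sub>0 t = x\<^sub>0 + J {0<..t} y" if t: "0 \<le> t" "ennreal t < T" for t
  proof (rule LIMSEQ_unique)
    show "(\<lambda>n. ?p (Suc n) t) \<longlonglongrightarrow> x x\<^sub>0 t" using p_lim[OF t] by (rule LIMSEQ_Suc)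
    show "(\<lambda>n. ?p (Suc n) t) \<longlonglongrightarrow> x\<^sub>0 + J {0<..t} y"
      unfolding picard_Suc by (intro tendsto_intros J_lim[OF t]) auto
  qed
  have y_eq: "y s = x\<^sub>0 + J {0<..<s} y" if s: "0 < s" "ennreal s < T" for s
  proof (rule LIMSEQ_unique)
    show "(\<lambda>n. left_lim (?p (Suc n)) s) \<longlonglongrightarrow> y s" using y[OF s] by (rule LIMSEQ_Suc)
    have "left_lim (?p (Suc n)) s = x\<^sub>0 + J {0<..<s} (left_lim (?p n))" for n
      unfolding picard_Suc
      by (intro left_lim_eqI tendsto_intros J_left_limit[OF admissible_left_lim[OF picard_cadlag] s])
    then show "(\<lambda>n. left_lim (?p (Suc n)) s) \<longlonglongrightarrow> x\<^sub>0 + J {0<..<s} y"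
      using s by (auto intro!: tendsto_intros J_lim[of s])
  qed
  have x_left: "(x x\<^sub>0 \<longlongrightarrow> y s) (at_left s)" if s: "0 < s" "ennreal s < T" for s
  proof -
    have "((\<lambda>u. x\<^sub>0 + J {0<..u} y) \<longlongrightarrow> y s) (at_left s)"
      unfolding y_eq[OF s] by (intro tendsto_intros J_left_limit[OF \<open>admissible T y\<close> s])
    moreover have "eventually (\<lambda>u. x x\<^sub>0 u = x\<^sub>0 + J {0<..u} y) (at_left s)"
      using eventually_at_left_real[OF s(1)]
      by eventually_elim (use ennreal_less_mono[OF s(2)] x_eq in auto)
    ultimately show ?thesis by (simp add: tendsto_cong)
  qed
  have x_right: "(x x\<^sub>0 \<longlongrightarrow> x x\<^sub>0 s) (at_right s)" if s: "0 \<le> s" "ennreal s < T" for s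
  proof -
    obtain b where b: "s < b" "ennreal b < T" using ennreal_less_imp_exists_greater[OF s(2,1)] by blast
    have "((\<lambda>u. x\<^sub>0 + J {0<..u} y) \<longlongrightarrow> x x\<^sub>0 s) (at_right s)"
      unfolding x_eq[OF s] by (intro tendsto_intros J_right_continuous[OF \<open>admissible T y\<close> s])
    moreover have "eventually (\<lambda>u. x x\<^sub>0 u = x\<^sub>0 + J {0<..u} y) (at_right s)"
      using eventually_at_right_real[OF b(1)]
      by eventually_elim (use ennreal_less_mono[OF b(2)] x_eq s(1) in auto)
    ultimately show ?thesis by (simp add: tendsto_cong)
  qed
  show "(\<lambda>n. ?p n t) \<longlonglongrightarrow> x x\<^sub>0 t" if "0 \<le> t" "ennreal t < T"
    by (rule p_lim[OF that])
  show "cadlag_on_before T (x x\<^sub>0)" by (rule cadlag_on_beforeI[OF x_right x_left])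
  show "x x\<^sub>0 t = x\<^sub>0 + J {0<..t} (left_lim (x x\<^sub>0))" if t: "0 \<le> t" "ennreal t < T"
    unfolding x_eq[OF t] using ennreal_less_mono[OF t(2)]
    by (intro arg_cong2[where f = "(+)"] J_cong refl) (auto simp: left_lim_eqI[OF x_left])
qed

end


section \<open>The exchange rate equation, path by path\<close>

definition exchange_operator ::
    "real \<Rightarrow> (real \<Rightarrow> real) \<Rightarrow> (real \<Rightarrow> real) \<Rightarrow> (real \<Rightarrow> real) \<Rightarrow> (real \<Rightarrow> real) \<Rightarrow>
     (real \<Rightarrow> real) \<Rightarrow> (real \<Rightarrow> real) \<Rightarrow> real \<Rightarrow> real" where
  "exchange_operator \<theta> g G v rd rf x t =
     (LINT s:{0..t}|lborel. left_lim x s * (left_lim rd s - left_lim rf s))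
       + stieltjes_integral (\<lambda>s. left_lim x s * \<theta>) g t
       + stieltjes_integral (\<lambda>s. left_lim x s * sqrt (left_lim v s)) G t"

lemma exchange_rate_equation_iff:
  "exchange_rate_equation \<theta> x\<^sub>0 g G v rd rf x t \<longleftrightarrow>
     x t = x\<^sub>0 + exchange_operator \<theta> g G v rd rf x t"
  by (simp add: exchange_rate_equation_def exchange_operator_def add.assoc)

text \<open>Written with \<open>stieltjes_integral\<close> and outside any locale, so that it is a
  total function of the paths and can be studied as a function of the scenario; on good paths it
  agrees with \<open>picard\<close>.\<close>

definition exchange_picard ::
    "real \<Rightarrow> (real \<Rightarrow> real) \<Rightarrow> (real \<Rightarrow> real) \<Rightarrow> (real \<Rightarrow> real) \<Rightarrow> (real \<Rightarrow> real) \<Rightarrow>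
     (real \<Rightarrow> real) \<Rightarrow> real \<Rightarrow> nat \<Rightarrow> real \<Rightarrow> real" where
  "exchange_picard \<theta> g G v rd rf x\<^sub>0 n =
     ((\<lambda>x t. x\<^sub>0 + exchange_operator \<theta> g G v rd rf x t) ^^ n) (\<lambda>_. x\<^sub>0)"

definition exchange_solution ::
    "real \<Rightarrow> (real \<Rightarrow> real) \<Rightarrow> (real \<Rightarrow> real) \<Rightarrow> (real \<Rightarrow> real) \<Rightarrow> (real \<Rightarrow> real) \<Rightarrow>
     (real \<Rightarrow> real) \<Rightarrow> real \<Rightarrow> real \<Rightarrow> real" where
  "exchange_solution \<theta> g G v rd rf x\<^sub>0 t = lim (\<lambda>n. exchange_picard \<theta> g G v rd rf x\<^sub>0 n t)"

lemma exchange_picard_Suc: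
  "exchange_picard \<theta> g G v rd rf x\<^sub>0 (Suc n) t =
     x\<^sub>0 + exchange_operator \<theta> g G v rd rf (exchange_picard \<theta> g G v rd rf x\<^sub>0 n) t"
  by (simp add: exchange_picard_def)

text \<open>Reconciles the closed interval of the drift integral with the half-open one of the
  Stieltjes integrals.\<close>

lemma set_integral_lborel_Icc_eq_Ioc:
  fixes f :: "real \<Rightarrow> real"
  shows "(LINT s:{a..b}|lborel. f s) = (LINT s:{a<..b}|lborel. f s)"
  unfolding set_lebesgue_integral_def
  by (rule integral_discrete_difference[where X = "{a}"]) (auto simp: indicator_def)

locale exchange_path =
  fixes \<theta> :: real and g G v rd rf :: "real \<Rightarrow> real" and T :: ennreal
  assumes g_bv: "locally_bounded_variation g" and G_bv: "locally_bounded_variation G"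
    and g_right: "0 \<le> s \<Longrightarrow> (g \<longlongrightarrow> g s) (at_right s)"
    and G_right: "0 \<le> s \<Longrightarrow> (G \<longlongrightarrow> G s) (at_right s)"
    and v: "cadlag_on_before T v" and rd: "cadlag_on_before T rd" and rf: "cadlag_on_before T rf"
begin

text \<open>Time, then the two Jordan parts of \<open>g\<close>, then those of \<open>G\<close>. The
  minus signs of the negative parts are moved into \<open>coefficients\<close>, which keeps all five
  integrators increasing.\<close>

definition integrators :: "nat \<Rightarrow> real \<Rightarrow> real" where
  "integrators i = [\<lambda>s. s, jordan_pos g, jordan_neg g, jordan_pos G, jordan_neg G] ! i"

definition measures :: "nat \<Rightarrow> real measure" where
  "measures i = (if i = 0 then lborel else interval_measure (integrators i))"

definition coefficients :: "nat \<Rightarrow> real \<Rightarrow> real" where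
  "coefficients i = [\<lambda>s. left_lim rd s - left_lim rf s, \<lambda>_. \<theta>, \<lambda>_. - \<theta>,
     \<lambda>s. sqrt (left_lim v s), \<lambda>s. - sqrt (left_lim v s)] ! i"

lemma less_5_cases:
  assumes "i \<in> {..<5 :: nat}"
  obtains "i = 0" | "i = 1" | "i = 2" | "i = 3" | "i = 4"
  using assms by force

lemma sqrt_v_left: "0 < s \<Longrightarrow> ennreal s < T \<Longrightarrow> ((\<lambda>u. sqrt (v u)) \<longlongrightarrow> sqrt (left_lim v s)) (at_left s)"
  by (intro tendsto_intros cadlag_left_lim[OF v])

lemma sqrt_v_cadlag: "cadlag_on_before T (\<lambda>u. sqrt (v u))"
  by (rule cadlag_on_beforeI[OF tendsto_real_sqrt[OF cadlag_at_right[OF v]] sqrt_v_left])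

sublocale linear_stieltjes "{..<5 :: nat}" measures integrators coefficients T
proof
  have const: "admissible T (\<lambda>_. k)" for k
    unfolding admissible_def by auto
  have sqrt: "admissible T (\<lambda>s. sqrt (left_lim v s))"
    by (rule admissible_left_limit[OF sqrt_v_cadlag sqrt_v_left])
  have neg_sqrt: "admissible T (\<lambda>s. - sqrt (left_lim v s))"
    using admissible_diff[OF const[of 0] sqrt] by simp
  fix i :: nat assume i: "i \<in> {..<5}"
  show "increment_measure (measures i) (integrators i)"
    using i increment_measure_lborel increment_measure_jordan[OF g_bv g_right]
      increment_measure_jordan[OF G_bv G_right]
    by (cases rule: less_5_cases) (simp_all add: measures_def integrators_def)
  show "admissible T (coefficients i)"
    using i const sqrt neg_sqrt admissible_diff[OF admissible_left_lim[OF rd] admissible_left_lim[OF rf]]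
    by (cases rule: less_5_cases) (simp_all add: coefficients_def)
qed simp

lemma exchange_operator_eq_J:
  "exchange_operator \<theta> g G v rd rf x t = J {0<..t} (left_lim x)"
proof -
  have 5: "J {0<..t} y = (\<Sum>i\<in>{0, 1, 2, 3, 4}. LINT s:{0<..t}|measures i. y s * coefficients i s)" for y
    unfolding J_def by (rule sum.cong) auto
  show ?thesis
    unfolding exchange_operator_def 5 stieltjes_integral_eq set_integral_lborel_Icc_eq_Ioc
    by (simp add: measures_def integrators_def coefficients_def set_lebesgue_integral_def
        mult.assoc[symmetric])
qed

lemma exchange_operator_0: "exchange_operator \<theta> g G v rd rf x 0 = 0"
  by (simp add: exchange_operator_eq_J)

lemma exchange_picard_eq_picard: "exchange_picard \<theta> g G v rd rf x\<^sub>0 n = picard x\<^sub>0 n"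
  unfolding exchange_picard_def picard_def exchange_operator_eq_J ..

lemma exchange_solution_eq: "exchange_solution \<theta> g G v rd rf x\<^sub>0 = (\<lambda>t. lim (\<lambda>n. picard x\<^sub>0 n t))"
  unfolding exchange_solution_def exchange_picard_eq_picard ..

lemma exchange_picard_cadlag: "cadlag_on_before T (exchange_picard \<theta> g G v rd rf x\<^sub>0 n)"
  unfolding exchange_picard_eq_picard by (rule picard_cadlag)

lemma exchange_picard_tendsto:
  assumes "0 \<le> t" "ennreal t < T"
  shows "(\<lambda>n. exchange_picard \<theta> g G v rd rf x\<^sub>0 n t) \<longlonglongrightarrow> exchange_solution \<theta> g G v rd rf x\<^sub>0 t"
  unfolding exchange_solution_eq exchange_picard_eq_picard
  using assms by (rule picard_limit_solves(1))

lemma exchange_solution_cadlag: "cadlag_on_before T (exchange_solution \<theta> g G v rd rf x\<^sub>0)"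
  unfolding exchange_solution_eq by (rule picard_limit_solves(2))

lemma exchange_solution_solves:
  assumes "0 \<le> t" "ennreal t < T"
  shows "exchange_rate_equation \<theta> x\<^sub>0 g G v rd rf (exchange_solution \<theta> g G v rd rf x\<^sub>0) t"
  unfolding exchange_rate_equation_iff exchange_operator_eq_J exchange_solution_eq
  using assms by (rule picard_limit_solves(3))

lemma exchange_solution_at_0:
  assumes "0 < T"
  shows "exchange_solution \<theta> g G v rd rf x\<^sub>0 0 = x\<^sub>0"
  using exchange_solution_solves[of 0 x\<^sub>0] assms
  by (simp add: exchange_rate_equation_iff exchange_operator_eq_J)

lemma exchange_solution_zero_absorbing:
  assumes "0 \<le> s" "s \<le> t" "ennreal t < T" "exchange_solution \<theta> g G v rd rf x\<^sub>0 s = 0"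
  shows "exchange_solution \<theta> g G v rd rf x\<^sub>0 t = 0"
  using exchange_solution_cadlag _ assms
  by (rule solution_zero_absorbing[where x\<^sub>0 = x\<^sub>0])
    (use exchange_solution_solves in \<open>simp add: exchange_rate_equation_iff exchange_operator_eq_J\<close>)

lemma exchange_solution_unique:
  assumes "cadlag_on_before T x" "cadlag_on_before T x'"
    and "\<And>t. 0 \<le> t \<Longrightarrow> ennreal t < T \<Longrightarrow> exchange_rate_equation \<theta> x\<^sub>0 g G v rd rf x t"
    and "\<And>t. 0 \<le> t \<Longrightarrow> ennreal t < T \<Longrightarrow> exchange_rate_equation \<theta> x\<^sub>0 g G v rd rf x' t"
    and "0 \<le> t" "ennreal t < T"
  shows "x t = x' t"
  using assms solution_unique[OF assms(1,2) _ _ assms(5,6)]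
  unfolding exchange_rate_equation_iff exchange_operator_eq_J by blast

text \<open>The link to measurability: the operator is a limit of finite expressions in path values.
  Left limits occur only in the limit, since at left endpoints the integrands are built from the
  values of \<open>x\<close>, \<open>v\<close>, \<open>rd\<close> and \<open>rf\<close>.\<close>

lemma left_sums_tendsto_exchange_operator:
  assumes x: "cadlag_on_before T x" and t: "0 \<le> t" "ennreal t < T"
  shows "(\<lambda>m. left_sum (\<lambda>s. x s * (rd s - rf s)) (\<lambda>s. s) 0 t m
      + left_sum (\<lambda>s. x s * \<theta>) g 0 t m + left_sum (\<lambda>s. x s * sqrt (v s)) G 0 t m)
    \<longlonglongrightarrow> exchange_operator \<theta> g G v rd rf x t"
proof -
  obtain K where K: "\<And>s. 0 \<le> s \<Longrightarrow> s \<le> t \<Longrightarrow> \<bar>x s\<bar> \<le> K" "0 < K"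
    using cadlag_bounded[OF x t] by blast
  obtain A where A: "\<And>s. 0 \<le> s \<Longrightarrow> s \<le> t \<Longrightarrow> \<bar>rd s - rf s\<bar> \<le> A"
    using cadlag_bounded[OF cadlag_diff[OF rd rf] t] by blast
  obtain C where C: "\<And>s. 0 \<le> s \<Longrightarrow> s \<le> t \<Longrightarrow> \<bar>sqrt (v s)\<bar> \<le> C"
    using cadlag_bounded[OF sqrt_v_cadlag t] by blast
  have lt: "ennreal s < T" if "s \<le> t" for s using that t ennreal_less_mono by blast
  have bound: "\<bar>x s * a\<bar> \<le> K * k" if "0 \<le> s" "s \<le> t" "\<bar>a\<bar> \<le> k" for s a k
    unfolding abs_mult using that K by (intro mult_mono) auto
  show ?thesis
    unfolding exchange_operator_def set_integral_lborel_Icc_eq_Ioc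
    using lt A C bound t
    by (intro tendsto_add left_sum_tendsto[OF increment_measure_lborel, where K = "K * A"]
        left_sum_tendsto_stieltjes_integral[OF g_bv g_right, where K = "K * \<bar>\<theta>\<bar>"]
        left_sum_tendsto_stieltjes_integral[OF G_bv G_right, where K = "K * C"]
        tendsto_intros cadlag_left_lim[OF x] cadlag_left_lim[OF rd] cadlag_left_lim[OF rf]
        cadlag_left_lim[OF v]) auto
qed

end

text \<open>The asymmetry is the point: the integrator is read up to time \<open>t\<close>, the
  integrand only strictly before, because for \<open>0 < t\<close> every left endpoint is less than
  \<open>t\<close>.\<close>

lemma borel_measurable_left_sum:
  assumes "0 < t"
    and "\<And>s. 0 \<le> s \<Longrightarrow> s < t \<Longrightarrow> (\<lambda>\<omega>. X \<omega> s) \<in> borel_measurable H"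
    and "\<And>s. 0 \<le> s \<Longrightarrow> s \<le> t \<Longrightarrow> (\<lambda>\<omega>. g \<omega> s) \<in> borel_measurable H"
  shows "(\<lambda>\<omega>. left_sum (X \<omega>) (g \<omega>) 0 t m) \<in> borel_measurable H"
  unfolding left_sum_def
  using assms(1)
  by (intro borel_measurable_sum borel_measurable_times borel_measurable_diff assms(2,3))
    (auto intro: grid_ge grid_le grid_less simp del: of_nat_Suc)

text \<open>\<open>H\<close> stands for a trace on scenarios still alive at \<open>t\<close>. The
  coefficients are taken only at times before \<open>t\<close>, where they are known to be
  measurable; the induction runs over all times up to \<open>t\<close> at once, as the next iterate
  reads the previous one at earlier times.\<close>

lemma borel_measurable_exchange_picard:
  fixes H :: "'a measure"
  assumes path: "\<And>\<omega>. \<omega> \<in> space H \<Longrightarrow> exchange_path (g \<omega>) (G \<omega>) (v \<omega>) (rd \<omega>) (rf \<omega>) (T \<omega>)"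
    and t: "\<And>\<omega>. \<omega> \<in> space H \<Longrightarrow> ennreal t < T \<omega>"
    and g: "\<And>s. 0 \<le> s \<Longrightarrow> s \<le> t \<Longrightarrow> (\<lambda>\<omega>. g \<omega> s) \<in> borel_measurable H"
    and G: "\<And>s. 0 \<le> s \<Longrightarrow> s \<le> t \<Longrightarrow> (\<lambda>\<omega>. G \<omega> s) \<in> borel_measurable H"
    and v: "\<And>s. 0 \<le> s \<Longrightarrow> s < t \<Longrightarrow> (\<lambda>\<omega>. v \<omega> s) \<in> borel_measurable H"
    and rd: "\<And>s. 0 \<le> s \<Longrightarrow> s < t \<Longrightarrow> (\<lambda>\<omega>. rd \<omega> s) \<in> borel_measurable H"
    and rf: "\<And>s. 0 \<le> s \<Longrightarrow> s < t \<Longrightarrow> (\<lambda>\<omega>. rf \<omega> s) \<in> borel_measurable H"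
    and s: "0 \<le> s" "s \<le> t"
  shows "(\<lambda>\<omega>. exchange_picard \<theta> (g \<omega>) (G \<omega>) (v \<omega>) (rd \<omega>) (rf \<omega>) x\<^sub>0 n s) \<in> borel_measurable H"
  using s
proof (induction n arbitrary: s)
  case 0
  then show ?case by (simp add: exchange_picard_def)
next
  case (Suc n)
  let ?x = "\<lambda>\<omega>. exchange_picard \<theta> (g \<omega>) (G \<omega>) (v \<omega>) (rd \<omega>) (rf \<omega>) x\<^sub>0 n"
  let ?\<Phi> = "\<lambda>\<omega>. exchange_operator \<theta> (g \<omega>) (G \<omega>) (v \<omega>) (rd \<omega>) (rf \<omega>) (?x \<omega>) s"
  have sqrt_v: "(\<lambda>\<omega>. sqrt (v \<omega> s)) \<in> borel_measurable H" if "0 \<le> s" "s < t" for s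
    using v[OF that] by measurable
  have "?\<Phi> \<in> borel_measurable H"
  \<comment> \<open>At time 0 there is no strictly earlier left endpoint; the operator is 0
    there.\<close>
  proof (cases "s = 0")
    case True
    have "exchange_operator \<theta> (g \<omega>) (G \<omega>) (v \<omega>) (rd \<omega>) (rf \<omega>) (?x \<omega>) 0 = 0" if "\<omega> \<in> space H" for \<omega>
      by (rule exchange_path.exchange_operator_0[OF path[OF that]])
    with True show ?thesis by (simp cong: measurable_cong)
  next
    case False
    with Suc.prems have "0 < s" by simp
    let ?\<Sigma> = "\<lambda>m \<omega>. left_sum (\<lambda>s. ?x \<omega> s * (rd \<omega> s - rf \<omega> s)) (\<lambda>s. s) 0 s m
      + left_sum (\<lambda>s. ?x \<omega> s * \<theta>) (g \<omega>) 0 s m + left_sum (\<lambda>s. ?x \<omega> s * sqrt (v \<omega> s)) (G \<omega>) 0 s m"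
    show ?thesis
    proof (rule borel_measurable_LIMSEQ_real)
      fix \<omega> assume \<omega>: "\<omega> \<in> space H"
      interpret exchange_path \<theta> "g \<omega>" "G \<omega>" "v \<omega>" "rd \<omega>" "rf \<omega>" "T \<omega>" by (rule path[OF \<omega>])
      show "(\<lambda>m. ?\<Sigma> m \<omega>) \<longlonglongrightarrow> ?\<Phi> \<omega>"
        using Suc.prems t[OF \<omega>]
        by (intro left_sums_tendsto_exchange_operator exchange_picard_cadlag)
          (auto intro: ennreal_less_mono)
    next
      fix m
      show "(\<lambda>\<omega>. ?\<Sigma> m \<omega>) \<in> borel_measurable H"
        using Suc.prems
        by (intro borel_measurable_add borel_measurable_left_sum[OF \<open>0 < s\<close>] borel_measurable_times
            borel_measurable_diff sqrt_v Suc.IH g G v rd rf) auto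
    qed
  qed
  then show ?case by (simp add: exchange_picard_Suc)
qed

lemma borel_measurable_exchange_solution:
  fixes H :: "'a measure"
  assumes path: "\<And>\<omega>. \<omega> \<in> space H \<Longrightarrow> exchange_path (g \<omega>) (G \<omega>) (v \<omega>) (rd \<omega>) (rf \<omega>) (T \<omega>)"
    and t: "\<And>\<omega>. \<omega> \<in> space H \<Longrightarrow> ennreal t < T \<omega>"
    and meas: "\<And>s. 0 \<le> s \<Longrightarrow> s \<le> t \<Longrightarrow> (\<lambda>\<omega>. g \<omega> s) \<in> borel_measurable H"
      "\<And>s. 0 \<le> s \<Longrightarrow> s \<le> t \<Longrightarrow> (\<lambda>\<omega>. G \<omega> s) \<in> borel_measurable H"
      "\<And>s. 0 \<le> s \<Longrightarrow> s < t \<Longrightarrow> (\<lambda>\<omega>. v \<omega> s) \<in> borel_measurable H"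
      "\<And>s. 0 \<le> s \<Longrightarrow> s < t \<Longrightarrow> (\<lambda>\<omega>. rd \<omega> s) \<in> borel_measurable H"
      "\<And>s. 0 \<le> s \<Longrightarrow> s < t \<Longrightarrow> (\<lambda>\<omega>. rf \<omega> s) \<in> borel_measurable H"
    and s: "0 \<le> s" "s \<le> t"
  shows "(\<lambda>\<omega>. exchange_solution \<theta> (g \<omega>) (G \<omega>) (v \<omega>) (rd \<omega>) (rf \<omega>) x\<^sub>0 s) \<in> borel_measurable H"
proof (rule borel_measurable_LIMSEQ_real)
  fix \<omega> assume \<omega>: "\<omega> \<in> space H"
  interpret exchange_path \<theta> "g \<omega>" "G \<omega>" "v \<omega>" "rd \<omega>" "rf \<omega>" "T \<omega>" by (rule path[OF \<omega>])
  show "(\<lambda>n. exchange_picard \<theta> (g \<omega>) (G \<omega>) (v \<omega>) (rd \<omega>) (rf \<omega>) x\<^sub>0 n s)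
      \<longlonglongrightarrow> exchange_solution \<theta> (g \<omega>) (G \<omega>) (v \<omega>) (rd \<omega>) (rf \<omega>) x\<^sub>0 s"
    using s ennreal_less_mono[OF t[OF \<omega>] s(2)] by (intro exchange_picard_tendsto)
qed (rule borel_measurable_exchange_picard[OF path t meas s])


section \<open>The first time at which a path is not positive\<close>

text \<open>On a path that stays positive the infimum is that of the empty set,
  \<open>\<top>\<close>, and the minimum returns the lifetime \<open>Z\<close>.\<close>

definition nonpos_time :: "ennreal \<Rightarrow> (real \<Rightarrow> real) \<Rightarrow> ennreal" where
  "nonpos_time Z x = min Z (Inf (ennreal ` {s. 0 \<le> s \<and> ennreal s < Z \<and> x s \<le> 0}))"

lemma nonpos_time_le: "nonpos_time Z x \<le> Z"
  by (simp add: nonpos_time_def)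

lemma nonpos_time_leI:
  assumes "0 \<le> s" "ennreal s < Z" "x s \<le> 0"
  shows "nonpos_time Z x \<le> ennreal s"
  unfolding nonpos_time_def using assms by (intro min.coboundedI2 Inf_lower) auto

lemma pos_before_nonpos_time:
  assumes "0 \<le> t" "ennreal t < nonpos_time Z x"
  shows "0 < x t"
  using nonpos_time_leI[of t Z x] order_less_le_trans[OF assms(2) nonpos_time_le] assms by force

text \<open>
  Reading off \<open>nonpos_time Z x \<le> t\<close> from the path up to \<open>t\<close> alone, without right-continuity of
  the filtration, is possible because \<open>0\<close> is absorbing.
\<close>

lemma nonpos_time_le_iff:
  assumes t: "0 \<le> t" "ennreal t < Z"
    and right: "\<And>s. 0 \<le> s \<Longrightarrow> ennreal s < Z \<Longrightarrow> (x \<longlongrightarrow> x s) (at_right s)"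
    and absorbing: "\<And>s u. 0 \<le> s \<Longrightarrow> s \<le> u \<Longrightarrow> ennreal u < Z \<Longrightarrow> x s = 0 \<Longrightarrow> x u = 0"
  shows "nonpos_time Z x \<le> ennreal t \<longleftrightarrow> (\<exists>q\<in>insert t (\<rat> \<inter> {0..t}). x q \<le> 0)"
proof
  assume "\<exists>q\<in>insert t (\<rat> \<inter> {0..t}). x q \<le> 0"
  then obtain q where q: "0 \<le> q" "q \<le> t" "x q \<le> 0" using t by auto
  then have "nonpos_time Z x \<le> ennreal q"
    using ennreal_less_mono[OF t(2)] by (intro nonpos_time_leI)
  then show "nonpos_time Z x \<le> ennreal t" using q by (meson ennreal_leI order_trans)
next
  assume le: "nonpos_time Z x \<le> ennreal t"
  show "\<exists>q\<in>insert t (\<rat> \<inter> {0..t}). x q \<le> 0"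
  proof (rule ccontr)
    assume neg: "\<not> ?thesis"
    then have pos: "0 < x q" if "q = t \<or> q \<in> \<rat> \<inter> {0..t}" for q using that by force
    \<comment> \<open>A zero would persist up to \<open>t\<close>, where the value is tested; a
      negative value would persist to the right of \<open>s\<close> by right-continuity and be seen
      at a rational time before \<open>t\<close>.\<close>
    have pos_le: "0 < x s" if s: "0 \<le> s" "s \<le> t" for s
    proof (rule ccontr)
      assume "\<not> 0 < x s"
      then consider "x s = 0" | "x s < 0" by linarith
      then show False
      proof cases
        case 1
        with absorbing[OF s t(2)] pos[of t] show False by simp
      next
        case 2
        with pos[of t] s have "s < t" by (cases "s = t") auto
        have "eventually (\<lambda>u. x u < 0) (at_right s)"
          using right[OF s(1)] ennreal_less_mono[OF t(2) s(2)] 2 by (intro order_tendstoD(2)[where y = "x s"]) auto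
        then obtain b where b: "s < b" "\<And>u. s < u \<Longrightarrow> u < b \<Longrightarrow> x u < 0"
          by (auto simp: eventually_at_right_field)
        obtain q where q: "q \<in> \<rat>" "s < q" "q < min b t"
          using Rats_dense_in_real[of s "min b t"] b(1) \<open>s < t\<close> by auto
        with b(2)[of q] pos[of q] s show False by auto
      qed
    qed
    \<comment> \<open>Positivity up to \<open>t\<close> only bounds the infimum below by
      \<open>t\<close>; positivity a little beyond makes the inequality strict.\<close>
    have "eventually (\<lambda>u. 0 < x u) (at_right t)"
      using right[OF t] pos_le[OF t(1) order_refl] by (intro order_tendstoD(1)[where y = "x t"]) auto
    then obtain b where b: "t < b" "\<And>u. t < u \<Longrightarrow> u < b \<Longrightarrow> 0 < x u"
      by (auto simp: eventually_at_right_field)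
    have "ennreal b \<le> Inf (ennreal ` {s. 0 \<le> s \<and> ennreal s < Z \<and> x s \<le> 0})"
    proof (rule Inf_greatest)
      fix r assume "r \<in> ennreal ` {s. 0 \<le> s \<and> ennreal s < Z \<and> x s \<le> 0}"
      then obtain s where s: "r = ennreal s" "0 \<le> s" "x s \<le> 0" by auto
      with pos_le[of s] b(2)[of s] have "b \<le> s" by linarith
      then show "ennreal b \<le> r" unfolding s(1) by (rule ennreal_leI)
    qed
    moreover have "ennreal t < ennreal b" using b(1) t(1) by (simp add: ennreal_less_iff)
    ultimately have "ennreal t < nonpos_time Z x" using t(2) unfolding nonpos_time_def by auto
    with le show False by simp
  qed
qed


section \<open>Measurability with respect to the augmented filtration\<close>

definition augmented_events ::
    "'a measure \<Rightarrow> (real \<Rightarrow> 'a \<Rightarrow> real) set \<Rightarrow> real \<Rightarrow> 'a set set" where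
  "augmented_events M D u = sigma_sets (space M) ((\<Union>X\<in>D. process_events M {0..u} X) \<union> null_sets M)"

lemma augmentation_generator_subset:
  "(\<Union>X\<in>D. process_events M {0..u} X) \<union> null_sets M \<subseteq> Pow (space M)"
  unfolding process_events_def using sets.sets_into_space by (auto dest: null_setsD2)

lemma augmented_events_subset: "augmented_events M D u \<subseteq> Pow (space M)"
  unfolding augmented_events_def using sigma_sets_into_sp[OF augmentation_generator_subset] by blast

lemma augmented_events_mono:
  assumes "D \<subseteq> D'" "u \<le> u'"
  shows "augmented_events M D u \<subseteq> augmented_events M D' u'"
  unfolding augmented_events_def
proof (rule sigma_sets_mono')
  have "process_events M {0..u} X \<subseteq> process_events M {0..u'} X" for X :: "real \<Rightarrow> 'a \<Rightarrow> real"
    using assms(2) unfolding process_events_def by fastforce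
  then show "(\<Union>X\<in>D. process_events M {0..u} X) \<union> null_sets M
      \<subseteq> (\<Union>X\<in>D'. process_events M {0..u'} X) \<union> null_sets M"
    using assms(1) by blast
qed

lemma space_usual_augmentation [simp]: "space (usual_augmentation M D t) = space M"
  by (simp add: usual_augmentation_def space_measure_of_conv)

lemma sets_usual_augmentation:
  "sets (usual_augmentation M D t) = sigma_sets (space M) (\<Inter>u\<in>{t<..}. augmented_events M D u)"
proof -
  have "(\<Inter>u\<in>{t<..}. augmented_events M D u) \<subseteq> Pow (space M)"
    using augmented_events_subset[of M D "t + 1"] by (intro INF_lower2[of "t + 1"]) auto
  then show ?thesis
    unfolding usual_augmentation_def augmented_events_def[symmetric] by (rule sets_measure_of)
qed

lemma sets_usual_augmentation_mono:
  assumes "D \<subseteq> D'" "s \<le> t"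
  shows "sets (usual_augmentation M D s) \<subseteq> sets (usual_augmentation M D' t)"
  unfolding sets_usual_augmentation
proof (intro sigma_sets_mono' INT_greatest)
  fix u assume "u \<in> {t<..}"
  then have "(\<Inter>u\<in>{s<..}. augmented_events M D u) \<subseteq> augmented_events M D u"
    using assms(2) by auto
  also have "\<dots> \<subseteq> augmented_events M D' u" by (rule augmented_events_mono[OF assms(1) order_refl])
  finally show "(\<Inter>u\<in>{s<..}. augmented_events M D u) \<subseteq> augmented_events M D' u" .
qed

lemma process_events_subset_usual_augmentation:
  assumes "X \<in> D"
  shows "process_events M {0..t} X \<subseteq> sets (usual_augmentation M D t)"
proof
  fix A assume A: "A \<in> process_events M {0..t} X"
  have "A \<in> augmented_events M D u" if "u > t" for u
  proof -
    have "A \<in> process_events M {0..u} X" using A that unfolding process_events_def by fastforce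
    then show ?thesis using assms unfolding augmented_events_def by (blast intro: sigma_sets.Basic)
  qed
  then show "A \<in> sets (usual_augmentation M D t)"
    unfolding sets_usual_augmentation by (blast intro: sigma_sets.Basic)
qed

lemma borel_measurable_usual_augmentation:
  assumes "X \<in> D" "0 \<le> s" "s \<le> t"
  shows "X s \<in> borel_measurable (usual_augmentation M D t)"
proof (rule measurableI)
  fix B :: "real set" assume "B \<in> sets borel"
  then have "X s -` B \<inter> space M \<in> process_events M {0..t} X"
    using assms unfolding process_events_def by auto
  with process_events_subset_usual_augmentation[OF assms(1)]
  show "X s -` B \<inter> space (usual_augmentation M D t) \<in> sets (usual_augmentation M D t)" by auto
qed simp

lemma filtered_spaceD:
  assumes "complete_filtered_prob_space M F" "0 \<le> t"
  shows "space (F t) = space M" "sets (F t) \<subseteq> sets M" "null_sets M \<subseteq> sets (F t)"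
    and "0 \<le> s \<Longrightarrow> s \<le> t \<Longrightarrow> sets (F s) \<subseteq> sets (F t)"
  using assms unfolding complete_filtered_prob_space_def subalgebra_def by blast+

lemma adapted_measurable:
  assumes "complete_filtered_prob_space M F" "adapted F X" "0 \<le> s" "s \<le> t"
  shows "X s \<in> borel_measurable (F t)"
proof -
  have "X s \<in> borel_measurable (F s)" using assms unfolding adapted_def by blast
  moreover have "space (F s) = space (F t)" "sets (F s) \<subseteq> sets (F t)"
    using filtered_spaceD[OF assms(1)] assms(3,4) by auto
  ultimately show ?thesis by (auto simp: measurable_def)
qed

text \<open>
  The augmented filtration need not be contained in \<open>F\<close> time by time, because \<open>F\<close> is not assumed
  right-continuous; the strict inequality makes up for this.
\<close>

lemma sets_usual_augmentation_subset:
  assumes F: "complete_filtered_prob_space M F" and D: "\<And>X. X \<in> D \<Longrightarrow> adapted F X"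
    and "0 \<le> s" "s < t"
  shows "sets (usual_augmentation M D s) \<subseteq> sets (F t)"
proof -
  have "0 \<le> t" using assms by simp
  note Ft = filtered_spaceD[OF F this]
  have "process_events M {0..t} X \<subseteq> sets (F t)" if "X \<in> D" for X
  proof
    fix A assume "A \<in> process_events M {0..t} X"
    then obtain u B where "0 \<le> u" "u \<le> t" "B \<in> sets borel" "A = X u -` B \<inter> space M"
      unfolding process_events_def by auto
    with measurable_sets[OF adapted_measurable[OF F D[OF that], of u t], of B] Ft(1)
    show "A \<in> sets (F t)" by simp
  qed
  then have "augmented_events M D t \<subseteq> sets (F t)"
    unfolding augmented_events_def Ft(1)[symmetric] using Ft(3) by (intro sets.sigma_sets_subset) auto
  moreover have "(\<Inter>u\<in>{s<..}. augmented_events M D u) \<subseteq> augmented_events M D t"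
    using assms by auto
  ultimately show ?thesis
    unfolding sets_usual_augmentation Ft(1)[symmetric] by (intro sets.sigma_sets_subset) auto
qed

lemma borel_measurable_restrict_mono:
  assumes "f \<in> borel_measurable (restrict_space B P)"
    and "space B = space A" "sets B \<subseteq> sets A" "Q \<subseteq> P"
  shows "f \<in> borel_measurable (restrict_space A Q)"
proof -
  have "(\<lambda>\<omega>. \<omega>) \<in> measurable A B"
    using assms(2,3) sets.sets_into_space by (intro measurableI) (auto simp: Int_absorb2)
  then have "(\<lambda>\<omega>. \<omega>) \<in> measurable (restrict_space A Q) (restrict_space B P)"
    using assms(4) by (intro measurable_restrict_space3) auto
  from measurable_compose[OF this assms(1)] show ?thesis .
qed


section \<open>Strong solutions of the exchange rate equation\<close>

text \<open>What the linear equation sees of its coefficients: lifetime, adaptedness and path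
  regularity. It puts the solutions of three different equations on the same footing.\<close>

definition coefficient_process ::
    "'a measure \<Rightarrow> (real \<Rightarrow> 'a measure) \<Rightarrow> (real \<Rightarrow> 'a \<Rightarrow> real) set \<Rightarrow> ('a \<Rightarrow> ennreal) \<Rightarrow>
     (real \<Rightarrow> 'a \<Rightarrow> real) \<Rightarrow> bool" where
  "coefficient_process M F D \<tau> X \<longleftrightarrow>
     markov_time F \<tau> \<and> (AE \<omega> in M. 0 < \<tau> \<omega>) \<and>
     adapted_before M (usual_augmentation M D) \<tau> X \<and>
     (AE \<omega> in M. cadlag_on_before (\<tau> \<omega>) (\<lambda>t. X t \<omega>))"

text \<open>Each coefficient is adapted to the augmentation of its own driving processes; enlarging
  the set of driving processes enlarges the augmentation.\<close>

lemma coefficient_processI: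
  assumes "unique_nonnegative_strong_solution M F D' \<zeta> E \<tau> X" "D' \<subseteq> D"
  shows "coefficient_process M F D \<tau> X"
proof -
  have *: "strong_solution M F D' \<zeta> E \<tau> X"
    using assms(1) by (simp add: unique_nonnegative_strong_solution_def)
  have "adapted_before M (usual_augmentation M D) \<tau> X"
    unfolding adapted_before_def
  proof (intro allI impI)
    fix t :: real assume "0 \<le> t"
    with * have "X t \<in> borel_measurable (restrict_space (usual_augmentation M D' t)
        {\<omega> \<in> space M. ennreal t < \<tau> \<omega>})"
      by (auto simp: strong_solution_def adapted_before_def)
    then show "X t \<in> borel_measurable (restrict_space (usual_augmentation M D t)
        {\<omega> \<in> space M. ennreal t < \<tau> \<omega>})"
      by (rule borel_measurable_restrict_mono)
        (use sets_usual_augmentation_mono[OF assms(2) order_refl] in auto)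
  qed
  with * show ?thesis by (simp add: coefficient_process_def strong_solution_def)
qed

lemma coefficient_process_measurable:
  assumes "coefficient_process M F D \<tau> X" "0 \<le> s"
    and "space A = space M" "sets (usual_augmentation M D s) \<subseteq> sets A"
    and "\<Omega> \<subseteq> {\<omega> \<in> space M. ennreal s < \<tau> \<omega>}"
  shows "X s \<in> borel_measurable (restrict_space A \<Omega>)"
proof (rule borel_measurable_restrict_mono[OF _ _ assms(4,5)])
  show "X s \<in> borel_measurable (restrict_space (usual_augmentation M D s)
      {\<omega> \<in> space M. ennreal s < \<tau> \<omega>})"
    using assms(1,2) by (simp add: coefficient_process_def adapted_before_def)
qed (use assms(3) in simp)

theorem exchange_rate_strong_solution_exists:
  fixes M :: "'a measure" and F :: "real \<Rightarrow> 'a measure"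
    and g G v rd rf :: "real \<Rightarrow> 'a \<Rightarrow> real" and \<tau>V \<tau>d \<tau>f :: "'a \<Rightarrow> ennreal"
  assumes F: "complete_filtered_prob_space M F"
    and D: "\<And>X. X \<in> D \<Longrightarrow> adapted F X" "g \<in> D" "G \<in> D"
    and g: "AE \<omega> in M. locally_bounded_variation (\<lambda>t. g t \<omega>)"
      "AE \<omega> in M. \<forall>s\<ge>0. ((\<lambda>t. g t \<omega>) \<longlongrightarrow> g s \<omega>) (at_right s)"
    and G: "AE \<omega> in M. locally_bounded_variation (\<lambda>t. G t \<omega>)"
      "AE \<omega> in M. \<forall>s\<ge>0. ((\<lambda>t. G t \<omega>) \<longlongrightarrow> G s \<omega>) (at_right s)"
    and v: "coefficient_process M F D \<tau>V v"
    and rd: "coefficient_process M F D \<tau>d rd"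
    and rf: "coefficient_process M F D \<tau>f rf"
    and "0 < x\<^sub>0"
  shows "\<exists>\<tau> S. unique_nonnegative_strong_solution M F D
           (\<lambda>\<omega>. min (\<tau>V \<omega>) (min (\<tau>d \<omega>) (\<tau>f \<omega>)))
           (\<lambda>\<omega>. exchange_rate_equation \<theta> x\<^sub>0 (\<lambda>t. g t \<omega>) (\<lambda>t. G t \<omega>)
                  (\<lambda>t. v t \<omega>) (\<lambda>t. rd t \<omega>) (\<lambda>t. rf t \<omega>)) \<tau> S"
proof -
  define \<zeta> where "\<zeta> \<omega> = min (\<tau>V \<omega>) (min (\<tau>d \<omega>) (\<tau>f \<omega>))" for \<omega>
  define E where "E \<omega> = exchange_rate_equation \<theta> x\<^sub>0 (\<lambda>t. g t \<omega>) (\<lambda>t. G t \<omega>)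
      (\<lambda>t. v t \<omega>) (\<lambda>t. rd t \<omega>) (\<lambda>t. rf t \<omega>)" for \<omega>
  define S where "S t \<omega> = exchange_solution \<theta> (\<lambda>t. g t \<omega>) (\<lambda>t. G t \<omega>)
      (\<lambda>t. v t \<omega>) (\<lambda>t. rd t \<omega>) (\<lambda>t. rf t \<omega>) x\<^sub>0 t" for t \<omega>
  define path where "path \<omega> = exchange_path (\<lambda>t. g t \<omega>) (\<lambda>t. G t \<omega>)
      (\<lambda>t. v t \<omega>) (\<lambda>t. rd t \<omega>) (\<lambda>t. rf t \<omega>)" for \<omega>
  have "AE \<omega> in M. path \<omega> (\<zeta> \<omega>) \<and> 0 < \<zeta> \<omega>"
  proof -
    have "AE \<omega> in M. 0 < \<tau>V \<omega>" "AE \<omega> in M. 0 < \<tau>d \<omega>" "AE \<omega> in M. 0 < \<tau>f \<omega>"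
      "AE \<omega> in M. cadlag_on_before (\<tau>V \<omega>) (\<lambda>t. v t \<omega>)"
      "AE \<omega> in M. cadlag_on_before (\<tau>d \<omega>) (\<lambda>t. rd t \<omega>)"
      "AE \<omega> in M. cadlag_on_before (\<tau>f \<omega>) (\<lambda>t. rf t \<omega>)"
      using v rd rf by (simp_all add: coefficient_process_def)
    with g G show ?thesis
    proof eventually_elim
      case (elim \<omega>)
      have "cadlag_on_before (\<zeta> \<omega>) (\<lambda>t. v t \<omega>)" "cadlag_on_before (\<zeta> \<omega>) (\<lambda>t. rd t \<omega>)"
        "cadlag_on_before (\<zeta> \<omega>) (\<lambda>t. rf t \<omega>)"
        by (rule elim(8-10)[THEN cadlag_on_before_mono], simp add: \<zeta>_def min_le_iff_disj)+
      then have "path \<omega> (\<zeta> \<omega>)"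
        unfolding path_def using elim(1-4) by unfold_locales auto
      with elim show ?case by (simp add: \<zeta>_def)
    qed
  qed
  \<comment> \<open>A single measurable null set collects all bad scenarios. It belongs to every
    \<open>F t\<close>, so removing it leaves the relevant events in the filtration.\<close>
  then obtain N where N: "{\<omega> \<in> space M. \<not> (path \<omega> (\<zeta> \<omega>) \<and> 0 < \<zeta> \<omega>)} \<subseteq> N" "emeasure M N = 0" "N \<in> sets M"
    by (rule AE_E)
  then have N_null: "N \<in> null_sets M" by auto
  define \<Omega> where "\<Omega> = space M - N"
  have \<Omega>: "path \<omega> (\<zeta> \<omega>)" "0 < \<zeta> \<omega>" if "\<omega> \<in> \<Omega>" for \<omega>
    using N(1) that by (auto simp: \<Omega>_def)
  have AE_\<Omega>: "AE \<omega> in M. \<omega> \<in> \<Omega>"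
    using AE_not_in[OF N_null] by (auto simp: \<Omega>_def)
  \<comment> \<open>The value 0 off \<open>\<Omega>\<close> keeps every event
    \<open>t < \<tau> \<omega>\<close> inside the good scenarios, where \<open>S\<close> is known to
    be a solution.\<close>
  define \<tau> where "\<tau> \<omega> = (if \<omega> \<in> \<Omega> then nonpos_time (\<zeta> \<omega>) (\<lambda>t. S t \<omega>) else 0)" for \<omega>
  have \<tau>_le: "\<tau> \<omega> \<le> \<zeta> \<omega>" for \<omega>
    by (simp add: \<tau>_def nonpos_time_le)
  have S_cadlag: "cadlag_on_before (\<zeta> \<omega>) (\<lambda>t. S t \<omega>)" if "\<omega> \<in> \<Omega>" for \<omega>
    using exchange_path.exchange_solution_cadlag[OF \<Omega>(1)[OF that, unfolded path_def]]
    by (simp add: S_def)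
  have S_solves: "E \<omega> (\<lambda>t. S t \<omega>) t" if "\<omega> \<in> \<Omega>" "0 \<le> t" "ennreal t < \<zeta> \<omega>" for \<omega> t
    using exchange_path.exchange_solution_solves[OF \<Omega>(1)[OF that(1), unfolded path_def] that(2,3)]
    by (simp add: S_def E_def)
  \<comment> \<open>\<open>A\<close> is left general for two uses: \<open>F t\<close>, which
    contains the augmentations at earlier times only, for the Markov time; and the augmentation at
    \<open>t\<close> itself, for adaptedness.\<close>
  have S_measurable: "S s \<in> borel_measurable (restrict_space A Q)"
    if "0 \<le> t" "space A = space M" "\<And>s. 0 \<le> s \<Longrightarrow> s < t \<Longrightarrow> sets (usual_augmentation M D s) \<subseteq> sets A"
      "\<And>X s. X \<in> D \<Longrightarrow> 0 \<le> s \<Longrightarrow> s \<le> t \<Longrightarrow> X s \<in> borel_measurable A"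
      "Q \<subseteq> {\<omega> \<in> \<Omega>. ennreal t < \<zeta> \<omega>}" "0 \<le> s" "s \<le> t" for A Q s t
  proof -
    have Q: "Q \<subseteq> \<Omega>" "\<And>\<omega>. \<omega> \<in> Q \<Longrightarrow> ennreal t < \<zeta> \<omega>" using that(5) by auto
    have lt: "Q \<subseteq> {\<omega> \<in> space M. ennreal u < \<tau>V \<omega>}" "Q \<subseteq> {\<omega> \<in> space M. ennreal u < \<tau>d \<omega>}"
      "Q \<subseteq> {\<omega> \<in> space M. ennreal u < \<tau>f \<omega>}" if "u < t" for u
      using Q ennreal_less_mono[of t _ u] that by (auto simp: \<Omega>_def \<zeta>_def)
    show ?thesis
      unfolding S_def
    proof (rule borel_measurable_exchange_solution[where T = \<zeta> and t = t])
      show "exchange_path (\<lambda>t. g t \<omega>) (\<lambda>t. G t \<omega>) (\<lambda>t. v t \<omega>) (\<lambda>t. rd t \<omega>) (\<lambda>t. rf t \<omega>) (\<zeta> \<omega>)"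
        if "\<omega> \<in> space (restrict_space A Q)" for \<omega>
        using that Q(1) \<Omega>(1) by (auto simp: space_restrict_space path_def)
      show "ennreal t < \<zeta> \<omega>" if "\<omega> \<in> space (restrict_space A Q)" for \<omega>
        using that Q(2) by (auto simp: space_restrict_space)
    next
      fix u :: real assume u: "0 \<le> u" "u < t"
      show "(\<lambda>\<omega>. v u \<omega>) \<in> borel_measurable (restrict_space A Q)"
        using coefficient_process_measurable[OF v u(1) that(2) that(3)[OF u] lt(1)[OF u(2)]] .
      show "(\<lambda>\<omega>. rd u \<omega>) \<in> borel_measurable (restrict_space A Q)"
        using coefficient_process_measurable[OF rd u(1) that(2) that(3)[OF u] lt(2)[OF u(2)]] .
      show "(\<lambda>\<omega>. rf u \<omega>) \<in> borel_measurable (restrict_space A Q)"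
        using coefficient_process_measurable[OF rf u(1) that(2) that(3)[OF u] lt(3)[OF u(2)]] .
    qed (use that D in \<open>auto intro!: measurable_restrict_space1\<close>)
  qed
  have markov: "markov_time F \<tau>"
    unfolding markov_time_def
  proof (intro allI impI)
    fix t :: real assume t: "0 \<le> t"
    note Ft = filtered_spaceD[OF F t]
    have N_sets: "N \<in> sets (F t)" using Ft(3) N_null by blast
    have "Measurable.pred (F t) (\<lambda>\<omega>. \<tau>V \<omega> \<le> ennreal t)" "Measurable.pred (F t) (\<lambda>\<omega>. \<tau>d \<omega> \<le> ennreal t)"
      "Measurable.pred (F t) (\<lambda>\<omega>. \<tau>f \<omega> \<le> ennreal t)"
      using v rd rf t by (auto simp: coefficient_process_def markov_time_def)
    then have "Measurable.pred (F t) (\<lambda>\<omega>. \<zeta> \<omega> \<le> ennreal t)"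
      unfolding \<zeta>_def min_le_iff_disj by measurable
    then have \<zeta>_sets: "{\<omega> \<in> space M. \<zeta> \<omega> \<le> ennreal t} \<in> sets (F t)"
      by (simp add: pred_def Ft(1))
    define Q where "Q = {\<omega> \<in> \<Omega>. ennreal t < \<zeta> \<omega>}"
    have "Q = space M - N - {\<omega> \<in> space M. \<zeta> \<omega> \<le> ennreal t}" by (auto simp: Q_def \<Omega>_def)
    then have Q_sets: "Q \<in> sets (F t)"
      using N_sets \<zeta>_sets Ft(1) sets.top[of "F t"] by auto
    have nonpos_sets: "{\<omega> \<in> Q. S q \<omega> \<le> 0} \<in> sets (F t)" if q: "0 \<le> q" "q \<le> t" for q
    proof -
      have "S q \<in> borel_measurable (restrict_space (F t) Q)"
        using sets_usual_augmentation_subset[OF F D(1)] adapted_measurable[OF F D(1)] q t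
        by (intro S_measurable[where t = t] Ft(1)) (auto simp: Q_def)
      then have "{\<omega> \<in> space (restrict_space (F t) Q). S q \<omega> \<le> 0} \<in> sets (restrict_space (F t) Q)"
        by measurable
      moreover have "space (restrict_space (F t) Q) = Q"
        using sets.sets_into_space[OF Q_sets] by (auto simp: space_restrict_space)
      ultimately show ?thesis using Q_sets by (auto simp: sets_restrict_space_iff)
    qed
    \<comment> \<open>On \<open>N\<close> the time is 0, and a lifetime \<open>\<zeta>\<close> that
      is over by \<open>t\<close> forces \<open>\<tau> \<le> t\<close>. Only on \<open>Q\<close> is
      there something to detect, by countably many events of \<open>F t\<close>.\<close>
    have "{\<omega> \<in> space M. \<tau> \<omega> \<le> ennreal t} =
        N \<union> {\<omega> \<in> space M. \<zeta> \<omega> \<le> ennreal t} \<union> (\<Union>q\<in>insert t (\<rat> \<inter> {0..t}). {\<omega> \<in> Q. S q \<omega> \<le> 0})"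
      (is "?l = ?r")
    proof (rule set_eqI)
      fix \<omega>
      have "N \<subseteq> space M" using N(3) sets.sets_into_space by blast
      consider "\<omega> \<notin> space M" | "\<omega> \<in> N" | "\<omega> \<in> \<Omega>" "\<zeta> \<omega> \<le> ennreal t" | "\<omega> \<in> Q"
        by (cases "\<zeta> \<omega> \<le> ennreal t") (auto simp: Q_def \<Omega>_def not_le)
      then show "\<omega> \<in> ?l \<longleftrightarrow> \<omega> \<in> ?r"
      proof cases
        case 1
        with \<open>N \<subseteq> space M\<close> show ?thesis by (auto simp: Q_def \<Omega>_def)
      next
        case 2
        with \<open>N \<subseteq> space M\<close> show ?thesis by (auto simp: \<tau>_def \<Omega>_def)
      next
        case 3
        then show ?thesis using \<tau>_le[of \<omega>] by (auto simp: \<Omega>_def)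
      next
        case 4
        then have \<omega>: "\<omega> \<in> \<Omega>" "ennreal t < \<zeta> \<omega>" by (auto simp: Q_def)
        interpret exchange_path \<theta> "\<lambda>t. g t \<omega>" "\<lambda>t. G t \<omega>" "\<lambda>t. v t \<omega>" "\<lambda>t. rd t \<omega>" "\<lambda>t. rf t \<omega>" "\<zeta> \<omega>"
          using \<Omega>(1)[OF \<omega>(1)] by (simp add: path_def)
        have "nonpos_time (\<zeta> \<omega>) (\<lambda>t. S t \<omega>) \<le> ennreal t
            \<longleftrightarrow> (\<exists>q\<in>insert t (\<rat> \<inter> {0..t}). S q \<omega> \<le> 0)"
          using exchange_solution_zero_absorbing[of _ _ x\<^sub>0]
          by (intro nonpos_time_le_iff t \<omega>(2) cadlag_at_right[OF S_cadlag[OF \<omega>(1)]]) (auto simp: S_def)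
        then show ?thesis using 4 \<omega> by (auto simp: \<tau>_def \<Omega>_def)
      qed
    qed
    also have "\<dots> \<in> sets (F t)"
      using nonpos_sets t countable_rat
      by (intro sets.Un N_sets \<zeta>_sets sets.countable_UN') auto
    finally show "Measurable.pred (F t) (\<lambda>\<omega>. \<tau> \<omega> \<le> ennreal t)" by (simp add: pred_def Ft(1))
  qed
  have \<tau>_pos: "0 < \<tau> \<omega>" if "\<omega> \<in> \<Omega>" for \<omega>
  proof -
    interpret exchange_path \<theta> "\<lambda>t. g t \<omega>" "\<lambda>t. G t \<omega>" "\<lambda>t. v t \<omega>" "\<lambda>t. rd t \<omega>" "\<lambda>t. rf t \<omega>" "\<zeta> \<omega>"
      using \<Omega>(1)[OF that] by (simp add: path_def)
    \<comment> \<open>At time 0 the detection reduces to the single value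
      \<open>S 0 \<omega>\<close>, which is the positive initial datum.\<close>
    have "nonpos_time (\<zeta> \<omega>) (\<lambda>t. S t \<omega>) \<le> ennreal 0
        \<longleftrightarrow> (\<exists>q\<in>insert 0 (\<rat> \<inter> {0..0}). S q \<omega> \<le> 0)"
      using exchange_solution_zero_absorbing[of _ _ x\<^sub>0] \<Omega>(2)[OF that]
      by (intro nonpos_time_le_iff cadlag_at_right[OF S_cadlag[OF that]]) (auto simp: S_def)
    moreover have "S 0 \<omega> = x\<^sub>0" using exchange_solution_at_0[OF \<Omega>(2)[OF that]] by (simp add: S_def)
    ultimately show ?thesis using that \<open>0 < x\<^sub>0\<close>
      by (auto simp: \<tau>_def not_le zero_less_iff_neq_zero)
  qed
  have adapted: "adapted_before M (usual_augmentation M D) \<tau> S"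
    unfolding adapted_before_def
  proof (intro allI impI)
    fix t :: real assume t: "0 \<le> t"
    have "{\<omega> \<in> space M. ennreal t < \<tau> \<omega>} \<subseteq> {\<omega> \<in> \<Omega>. ennreal t < \<zeta> \<omega>}"
      by (auto simp: \<tau>_def intro: order_less_le_trans[OF _ nonpos_time_le] split: if_splits)
    then show "S t \<in> borel_measurable (restrict_space (usual_augmentation M D t)
        {\<omega> \<in> space M. ennreal t < \<tau> \<omega>})"
      using t sets_usual_augmentation_mono[of D D _ t M]
      by (intro S_measurable[where t = t] borel_measurable_usual_augmentation) auto
  qed
  have solution: "strong_solution M F D \<zeta> E \<tau> S"
    unfolding strong_solution_def
  proof (intro conjI markov adapted)
    show "AE \<omega> in M. 0 < \<tau> \<omega>" using AE_\<Omega> by eventually_elim (rule \<tau>_pos)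
    show "AE \<omega> in M. \<tau> \<omega> \<le> \<zeta> \<omega>" by (simp add: \<tau>_le)
    show "AE \<omega> in M. cadlag_on_before (\<tau> \<omega>) (\<lambda>t. S t \<omega>)"
      using AE_\<Omega> by eventually_elim (rule cadlag_on_before_mono[OF S_cadlag \<tau>_le])
    show "AE \<omega> in M. \<forall>t\<ge>0. ennreal t < \<tau> \<omega> \<longrightarrow> E \<omega> (\<lambda>s. S s \<omega>) t"
      using AE_\<Omega> by eventually_elim (use S_solves \<tau>_le in \<open>blast intro: order_less_le_trans\<close>)
  qed
  have nonneg: "nonnegative_before M \<tau> S"
    unfolding nonnegative_before_def using AE_\<Omega>
  proof eventually_elim
    case (elim \<omega>)
    then show ?case
      using pos_before_nonpos_time[of _ "\<zeta> \<omega>" "\<lambda>t. S t \<omega>"] by (auto simp: \<tau>_def intro: less_imp_le)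
  qed
  have unique: "pathwise_unique M F D \<zeta> E \<tau> S"
    unfolding pathwise_unique_def
  proof (intro allI impI)
    fix \<tau>' S' assume "strong_solution M F D \<zeta> E \<tau>' S'"
    then have "AE \<omega> in M. \<tau>' \<omega> \<le> \<zeta> \<omega>" "AE \<omega> in M. cadlag_on_before (\<tau>' \<omega>) (\<lambda>t. S' t \<omega>)"
      "AE \<omega> in M. \<forall>t\<ge>0. ennreal t < \<tau>' \<omega> \<longrightarrow> E \<omega> (\<lambda>s. S' s \<omega>) t"
      by (simp_all add: strong_solution_def)
    with AE_\<Omega> show "AE \<omega> in M. \<forall>t\<ge>0. ennreal t < min (\<tau> \<omega>) (\<tau>' \<omega>) \<longrightarrow> S t \<omega> = S' t \<omega>"
    proof eventually_elim
      case (elim \<omega>)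
      interpret Z: exchange_path \<theta> "\<lambda>t. g t \<omega>" "\<lambda>t. G t \<omega>" "\<lambda>t. v t \<omega>" "\<lambda>t. rd t \<omega>" "\<lambda>t. rf t \<omega>" "\<zeta> \<omega>"
        using \<Omega>(1)[OF elim(1)] by (simp add: path_def)
      let ?T = "min (\<tau> \<omega>) (\<tau>' \<omega>)"
      have le: "?T \<le> \<zeta> \<omega>" "?T \<le> \<tau>' \<omega>" using \<tau>_le[of \<omega>] by (auto intro: min.coboundedI1)
      \<comment> \<open>The locale is entered again with the shorter lifetime \<open>?T\<close>,
        because its uniqueness lemma compares paths that solve the equation on its whole
        lifetime.\<close>
      interpret exchange_path \<theta> "\<lambda>t. g t \<omega>" "\<lambda>t. G t \<omega>" "\<lambda>t. v t \<omega>" "\<lambda>t. rd t \<omega>" "\<lambda>t. rf t \<omega>" ?T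
        using Z.g_bv Z.G_bv Z.g_right Z.G_right cadlag_on_before_mono[OF Z.v le(1)]
          cadlag_on_before_mono[OF Z.rd le(1)] cadlag_on_before_mono[OF Z.rf le(1)]
        by unfold_locales
      show ?case
      proof (intro allI impI)
        fix t assume t: "0 \<le> t" "ennreal t < ?T"
        show "S t \<omega> = S' t \<omega>"
        proof (rule exchange_solution_unique[of "\<lambda>t. S t \<omega>" "\<lambda>t. S' t \<omega>" x\<^sub>0, OF _ _ _ _ t])
          show "cadlag_on_before ?T (\<lambda>t. S t \<omega>)"
            by (rule cadlag_on_before_mono[OF S_cadlag[OF elim(1)] le(1)])
          show "cadlag_on_before ?T (\<lambda>t. S' t \<omega>)"
            by (rule cadlag_on_before_mono[OF elim(3) le(2)])
          fix u assume u: "0 \<le> u" "ennreal u < ?T"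
          show "exchange_rate_equation \<theta> x\<^sub>0 (\<lambda>t. g t \<omega>) (\<lambda>t. G t \<omega>) (\<lambda>t. v t \<omega>) (\<lambda>t. rd t \<omega>)
              (\<lambda>t. rf t \<omega>) (\<lambda>t. S t \<omega>) u"
            using S_solves[OF elim(1) u(1) order_less_le_trans[OF u(2) le(1)]] by (simp add: E_def)
          show "exchange_rate_equation \<theta> x\<^sub>0 (\<lambda>t. g t \<omega>) (\<lambda>t. G t \<omega>) (\<lambda>t. v t \<omega>) (\<lambda>t. rd t \<omega>)
              (\<lambda>t. rf t \<omega>) (\<lambda>t. S' t \<omega>) u"
            using elim(4) u(1) order_less_le_trans[OF u(2) le(2)] by (simp add: E_def)
        qed
      qed
    qed
  qed
  have "unique_nonnegative_strong_solution M F D \<zeta> E \<tau> S"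
    using solution nonneg unique by (simp add: unique_nonnegative_strong_solution_def)
  then show ?thesis unfolding \<zeta>_def[abs_def] E_def[abs_def] by blast
qed

text \<open>A path of \<open>W\<close> is continuous on nonnegative arguments only, so the time
  change must stay nonnegative, which monotonicity and the value 0 at time 0 ensure. Jumps of
  \<open>\<gamma>\<close> carry over, but right-continuity survives the composition.\<close>

lemma time_changed_right_continuous:
  fixes W :: "real \<Rightarrow> 'a \<Rightarrow> real ^ 'n"
  assumes W: "continuous_on {0..} (\<lambda>t. W t \<omega>)"
    and mono: "mono_on {0..} (\<lambda>t. \<gamma> t \<omega>)" and "\<gamma> 0 \<omega> = 0"
    and right: "((\<lambda>t. \<gamma> t \<omega>) \<longlongrightarrow> \<gamma> s \<omega>) (at_right s)" and "0 \<le> s"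
  shows "((\<lambda>t. time_changed W \<gamma> j t \<omega>) \<longlongrightarrow> time_changed W \<gamma> j s \<omega>) (at_right s)"
proof -
  have pos: "0 \<le> \<gamma> t \<omega>" if "0 \<le> t" for t
    using mono_onD[OF mono, of 0 t] that assms(3) by simp
  have "((\<lambda>t. W (\<gamma> t \<omega>) \<omega>) \<longlongrightarrow> W (\<gamma> s \<omega>) \<omega>) (at_right s)"
  proof (rule continuous_on_tendsto_compose[OF W right])
    show "eventually (\<lambda>t. \<gamma> t \<omega> \<in> {0..}) (at_right s)"
      using assms(5) pos by (intro eventually_mono[OF eventually_at_right_less]) auto
  qed (use pos assms(5) in auto)
  then show ?thesis unfolding time_changed_def by (rule tendsto_vec_nth)
qed


theorem theorem3p6:
  fixes M :: "'a measure" and F :: "real \<Rightarrow> 'a measure"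
    and W :: "real \<Rightarrow> 'a \<Rightarrow> real ^ 4" and \<gamma> :: "real \<Rightarrow> 'a \<Rightarrow> real"
    and \<Gamma> :: "4 \<Rightarrow> real \<Rightarrow> 'a \<Rightarrow> real"
    and \<rho>sv \<rho>sd \<rho>sf \<rho>vd \<rho>vf \<rho>df \<alpha> \<beta> :: real
    and \<kappa>v \<kappa>d \<kappa>f av ad af \<sigma>v \<sigma>d \<sigma>f \<theta>s \<theta>v \<theta>d \<theta>f S0 V0 rd0 rf0 :: real
    and V rd rf :: "real \<Rightarrow> 'a \<Rightarrow> real" and \<tau>V \<tau>d \<tau>f :: "'a \<Rightarrow> ennreal"
  defines "\<Gamma> \<equiv> time_changed W \<gamma>"
  assumes "complete_filtered_prob_space M F"
    and "\<rho>sv \<in> {-1<..<1}" "\<rho>sd \<in> {-1<..<1}" "\<rho>sf \<in> {-1<..<1}"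
        "\<rho>vd \<in> {-1<..<1}" "\<rho>vf \<in> {-1<..<1}" "\<rho>df \<in> {-1<..<1}"
    and "positive_definite (correlation_matrix_4 \<rho>sv \<rho>sd \<rho>sf \<rho>vd \<rho>vf \<rho>df)"
    and "correlated_brownian_motion M (correlation_matrix_4 \<rho>sv \<rho>sd \<rho>sf \<rho>vd \<rho>vf \<rho>df) W"
    and "\<alpha> > 0" "\<beta> > 0" "gamma_subordinator M \<alpha> \<beta> \<gamma>"
    and "independent_processes M \<gamma> W"
    and "adapted F \<gamma>" "\<And>j. adapted F (\<Gamma> j)"
    and "\<And>j. AE \<omega> in M. locally_bounded_variation (\<lambda>t. \<Gamma> j t \<omega>)"
    and "\<kappa>v > 0" "\<kappa>d > 0" "\<kappa>f > 0" "av > 0" "ad > 0" "af > 0" "\<sigma>v > 0" "\<sigma>d > 0" "\<sigma>f > 0"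
    and "\<theta>s \<ge> 0" "\<theta>v \<ge> 0" "\<theta>d \<ge> 0" "\<theta>f \<ge> 0"
    and "S0 > 0" "V0 > 0" "rd0 > 0" "rf0 > 0"
    and "unique_nonnegative_strong_solution M F {\<gamma>, \<Gamma> 2} (\<lambda>_. \<top>)
           (\<lambda>\<omega>. cir_equation \<kappa>v av \<theta>v \<sigma>v V0 (\<lambda>t. \<gamma> t \<omega>) (\<lambda>t. \<Gamma> 2 t \<omega>)) \<tau>V V"
    and "unique_nonnegative_strong_solution M F {\<gamma>, \<Gamma> 3} (\<lambda>_. \<top>)
           (\<lambda>\<omega>. cir_equation \<kappa>d ad \<theta>d \<sigma>d rd0 (\<lambda>t. \<gamma> t \<omega>) (\<lambda>t. \<Gamma> 3 t \<omega>)) \<tau>d rd"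
    and "unique_nonnegative_strong_solution M F {\<gamma>, \<Gamma> 2, \<Gamma> 4} \<tau>V
           (\<lambda>\<omega>. foreign_rate_equation \<kappa>f af \<theta>f \<sigma>f \<rho>sf rf0 (\<lambda>t. \<gamma> t \<omega>) (\<lambda>t. \<Gamma> 4 t \<omega>)
                  (\<lambda>t. V t \<omega>)) \<tau>f rf"
  shows "\<exists>\<tau>S S. unique_nonnegative_strong_solution M F {\<gamma>, \<Gamma> 1, \<Gamma> 2, \<Gamma> 3, \<Gamma> 4}
           (\<lambda>\<omega>. min (\<tau>V \<omega>) (min (\<tau>d \<omega>) (\<tau>f \<omega>)))
           (\<lambda>\<omega>. exchange_rate_equation \<theta>s S0 (\<lambda>t. \<gamma> t \<omega>) (\<lambda>t. \<Gamma> 1 t \<omega>)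
                  (\<lambda>t. V t \<omega>) (\<lambda>t. rd t \<omega>) (\<lambda>t. rf t \<omega>)) \<tau>S S"
proof -
  let ?D = "{\<gamma>, \<Gamma> 1, \<Gamma> 2, \<Gamma> 3, \<Gamma> 4}"
  have \<Gamma>_def: "\<Gamma> = time_changed W \<gamma>" by (rule meta_eq_to_obj_eq[OF assms(1)])
  have levy: "levy_process M \<gamma>" and mono: "AE \<omega> in M. mono_on {0..} (\<lambda>t. \<gamma> t \<omega>)"
    using \<open>gamma_subordinator M \<alpha> \<beta> \<gamma>\<close> by (simp_all add: gamma_subordinator_def)
  have zero: "AE \<omega> in M. \<gamma> 0 \<omega> = 0" and cadlag: "AE \<omega> in M. cadlag_on_before \<top> (\<lambda>t. \<gamma> t \<omega>)"
    using levy by (simp_all add: levy_process_def)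
  have W: "AE \<omega> in M. continuous_on {0..} (\<lambda>t. W t \<omega>)"
    using \<open>correlated_brownian_motion M _ W\<close> by (simp add: correlated_brownian_motion_def)
  have \<gamma>_right: "AE \<omega> in M. \<forall>s\<ge>0. ((\<lambda>t. \<gamma> t \<omega>) \<longlongrightarrow> \<gamma> s \<omega>) (at_right s)"
    using cadlag by eventually_elim (auto intro: cadlag_at_right)
  have \<Gamma>_right: "AE \<omega> in M. \<forall>s\<ge>0. ((\<lambda>t. \<Gamma> 1 t \<omega>) \<longlongrightarrow> \<Gamma> 1 s \<omega>) (at_right s)"
    unfolding \<Gamma>_def using W mono zero \<gamma>_right
    by eventually_elim (blast intro: time_changed_right_continuous)
  show ?thesis
  proof (rule exchange_rate_strong_solution_exists)
    show "complete_filtered_prob_space M F" by fact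
    show "adapted F X" if "X \<in> ?D" for X
      using that \<open>adapted F \<gamma>\<close> \<open>\<And>j. adapted F (\<Gamma> j)\<close> by auto
    show "AE \<omega> in M. locally_bounded_variation (\<lambda>t. \<gamma> t \<omega>)"
      using mono by eventually_elim (rule mono_on_imp_locally_bounded_variation)
    show "AE \<omega> in M. locally_bounded_variation (\<lambda>t. \<Gamma> 1 t \<omega>)" by fact
    show "coefficient_process M F ?D \<tau>V V"
      using \<open>unique_nonnegative_strong_solution M F {\<gamma>, \<Gamma> 2} _ _ \<tau>V V\<close>
      by (rule coefficient_processI) auto
    show "coefficient_process M F ?D \<tau>d rd"
      using \<open>unique_nonnegative_strong_solution M F {\<gamma>, \<Gamma> 3} _ _ \<tau>d rd\<close>
      by (rule coefficient_processI) auto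
    show "coefficient_process M F ?D \<tau>f rf"
      using \<open>unique_nonnegative_strong_solution M F {\<gamma>, \<Gamma> 2, \<Gamma> 4} _ _ \<tau>f rf\<close>
      by (rule coefficient_processI) auto
  qed (use \<gamma>_right \<Gamma>_right \<open>S0 > 0\<close> in auto)
qed

end
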